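(* Let $\Bbbk$ be a field, let $f_1,\ldots,f_m$ be homogeneous polynomials forming a regular sequence in the polynomial ring $S=\Bbbk[x_1,\ldots,x_n]$, and let $r=(r_0,\ldots,r_m)$ be a non-negative integer sequence. Then $r\in \mathrm{RS}(\mathbf{K}(f_1,\ldots,f_m))$ if and only if it is the zero sequence or $r_0=1$ and $$0\le r_{i+1}\le r_i^{(i)}\quad\text{for } 1\le i\le m-1.$$
   Context: $S$ is standard graded ($\deg x_i=1$). Koszul complex: $\mathbf{K}(f_1,\ldots,f_m)$ is the complex $0\to K_m\to\cdots\to K_1\to K_0=S\to 0$, where $K_d$ is the graded free $S$-module with basis $\{e_T : T\subseteq\{1,\ldots,m\},\ |T|=d\}$ ($e_T$ in degree $\sum_{i\in T}\deg f_i$), and for $T=\{i_1<\cdots<i_d\}$ the differential is $\partial_d(e_T)=\sum_{j=1}^d(-1)^j f_{i_j}e_{T\setminus\{i_j\}}$. Subcomplex: a complex of free modules $\mathbf{F}=(F_i,f_i)$ is a subcomplex of a complex of free modules $\mathbf{G}=(G_i,g_i)$ over the same ring if there are split injective maps $\varphi_i:F_i\to G_i$ with $\varphi_i\circ f_{i+1}=g_{i+1}\circ\varphi_{i+1}$ for all $i$. In the case considered here the maps $\varphi_i$ can be represented by matrices with entries in $\Bbbk$ and full column rank. Rank sequences: $\mathrm{rs}(\mathbf{F})=(r_0,r_1,\ldots)$ with $r_i=\operatorname{rank}F_i$, and $\mathrm{RS}(\mathbf{G})$ is the set of all $\mathrm{rs}(\mathbf{F})$ for $\mathbf{F}$ a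 subcomplex of $\mathbf{G}$. Macaulay expansion: for positive integers $a,i$ there is a unique expression $a=\binom{a_i}{i}+\binom{a_{i-1}}{i-1}+\cdots+\binom{a_j}{j}$ with $a_i>a_{i-1}>\cdots>a_j\ge j\ge 1$; set $a^{(i)}=\binom{a_i}{i+1}+\binom{a_{i-1}}{i}+\cdots+\binom{a_j}{j+1}$, and $0^{(i)}=0$.
   Formalization: The condition r_1 ≤ m is added to the right-hand side of the equivalence; without it the claim is false, e.g. m = n = 1, f_1 = x_1, r = (1,2) meets the printed condition but is not a rank sequence of a subcomplex. *)

theory Defs
  imports Complex_Main "HOL-Library.Poly_Mapping"
begin

section \<open>Homogeneous polynomials and regular sequences\<close>

text \<open>A monomial is an exponent vector in \<^typ>\<open>'n \<Rightarrow>\<^sub>0 nat\<close>; the convolution product of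
  \<^typ>\<open>('n \<Rightarrow>\<^sub>0 nat) \<Rightarrow>\<^sub>0 'k\<close> is polynomial multiplication.\<close>

type_synonym ('n, 'k) mpoly = "('n \<Rightarrow>\<^sub>0 nat) \<Rightarrow>\<^sub>0 'k"

definition monom_degree :: "('n \<Rightarrow>\<^sub>0 nat) \<Rightarrow> nat" where
  "monom_degree t = (\<Sum>x\<in>Poly_Mapping.keys t. Poly_Mapping.lookup t x)"

definition homogeneous :: "('n, 'k::zero) mpoly \<Rightarrow> bool" where
  "homogeneous p \<longleftrightarrow> (\<exists>d. \<forall>t\<in>Poly_Mapping.keys p. monom_degree t = d)"

lemma module_times: "module ((*) :: 'a::comm_ring_1 \<Rightarrow> 'a \<Rightarrow> 'a)"
  by standard (simp_all add: algebra_simps)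

definition ideal_gen :: "'a::comm_ring_1 set \<Rightarrow> 'a set" where
  "ideal_gen = module.span (*)"

text \<open>The sequence is \<open>f 1, \<dots>, f m\<close>; each \<open>f i\<close> is a nonzerodivisor modulo its predecessors,
  and the quotient by the whole sequence is nonzero.\<close>

definition regular_sequence :: "nat \<Rightarrow> (nat \<Rightarrow> 'a::comm_ring_1) \<Rightarrow> bool" where
  "regular_sequence m f \<longleftrightarrow>
     (\<forall>i\<in>{1..m}. \<forall>g. f i * g \<in> ideal_gen (f ` {1..<i}) \<longrightarrow> g \<in> ideal_gen (f ` {1..<i})) \<and>
     1 \<notin> ideal_gen (f ` {1..m})"


section \<open>Complexes of free modules of finite rank\<close>

definition fm_scale :: "'a::comm_ring_1 \<Rightarrow> ('b \<Rightarrow>\<^sub>0 'a) \<Rightarrow> ('b \<Rightarrow>\<^sub>0 'a)" where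
  "fm_scale c v = Poly_Mapping.map ((*) c) v"

lemma lookup_fm_scale: "Poly_Mapping.lookup (fm_scale c v) b = c * Poly_Mapping.lookup v b"
  by (simp add: fm_scale_def Poly_Mapping.map.rep_eq when_def)

lemma module_fm_scale: "module (fm_scale :: 'a::comm_ring_1 \<Rightarrow> ('b \<Rightarrow>\<^sub>0 'a) \<Rightarrow> _)"
  by standard
    (auto intro!: poly_mapping_eqI simp: lookup_fm_scale lookup_add algebra_simps)

definition free_module :: "'b set \<Rightarrow> ('b \<Rightarrow>\<^sub>0 'a::comm_ring_1) set" where
  "free_module B = {v. Poly_Mapping.keys v \<subseteq> B}"

text \<open>A homomorphism between the free modules on \<open>B\<close> and on \<open>C\<close> is given by a linear map on the
  ambient module. Every homomorphism arises this way, by extending it by zero on the basis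
  elements outside \<open>B\<close>.\<close>

definition free_hom :: "'b set \<Rightarrow> 'c set \<Rightarrow> (('b \<Rightarrow>\<^sub>0 'a::comm_ring_1) \<Rightarrow> ('c \<Rightarrow>\<^sub>0 'a)) \<Rightarrow> bool" where
  "free_hom B C \<phi> \<longleftrightarrow> module_hom fm_scale fm_scale \<phi> \<and> \<phi> ` free_module B \<subseteq> free_module C"

definition split_injective :: "'b set \<Rightarrow> 'c set \<Rightarrow> (('b \<Rightarrow>\<^sub>0 'a::comm_ring_1) \<Rightarrow> ('c \<Rightarrow>\<^sub>0 'a)) \<Rightarrow> bool" where
  "split_injective B C \<phi> \<longleftrightarrow> free_hom B C \<phi> \<and>
     (\<exists>\<psi>. free_hom C B \<psi> \<and> (\<forall>v\<in>free_module B. \<psi> (\<phi> v) = v))"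

text \<open>The module in position \<open>i\<close> is \<open>free_module (basis F i)\<close>, and \<open>diff F i\<close> maps position \<open>i\<close>
  to position \<open>i - 1\<close>; the value \<open>diff F 0\<close> is irrelevant.\<close>

record (overloaded) ('b, 'a) based_complex =
  basis :: "nat \<Rightarrow> 'b set"
  diff :: "nat \<Rightarrow> ('b \<Rightarrow>\<^sub>0 'a) \<Rightarrow> ('b \<Rightarrow>\<^sub>0 'a)"

definition free_complex :: "('b, 'a::comm_ring_1) based_complex \<Rightarrow> bool" where
  "free_complex F \<longleftrightarrow>
     (\<forall>i. finite (basis F i)) \<and>
     (\<forall>i. free_hom (basis F (Suc i)) (basis F i) (diff F (Suc i))) \<and>
     (\<forall>i. \<forall>v\<in>free_module (basis F (Suc (Suc i))). diff F (Suc i) (diff F (Suc (Suc i)) v) = 0)"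

definition subcomplex :: "('b, 'a::comm_ring_1) based_complex \<Rightarrow> ('c, 'a) based_complex \<Rightarrow> bool" where
  "subcomplex F G \<longleftrightarrow>
     (\<exists>\<phi>. (\<forall>i. split_injective (basis F i) (basis G i) (\<phi> i)) \<and>
          (\<forall>i. \<forall>v\<in>free_module (basis F (Suc i)).
             \<phi> i (diff F (Suc i) v) = diff G (Suc i) (\<phi> (Suc i) v)))"

definition rank_seq :: "('b, 'a) based_complex \<Rightarrow> nat \<Rightarrow> nat" where
  "rank_seq F i = card (basis F i)"

text \<open>Indexing the bases of \<open>F\<close> by \<^typ>\<open>nat\<close> loses nothing, since the ranks are finite.\<close>

definition RS :: "('c, 'a::comm_ring_1) based_complex \<Rightarrow> (nat \<Rightarrow> nat) set" where
  "RS G = {rank_seq F | F :: (nat, 'a) based_complex. free_complex F \<and> subcomplex F G}"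


section \<open>The Koszul complex\<close>

text \<open>\<open>e\<^sub>T\<close> is \<open>Poly_Mapping.single T 1\<close>. The sign exponent of \<open>t \<in> T\<close> is the position of \<open>t\<close> in
  the increasing enumeration of \<open>T\<close>, counted from 1.\<close>

definition koszul_diff :: "(nat \<Rightarrow> 'a::comm_ring_1) \<Rightarrow> (nat set \<Rightarrow>\<^sub>0 'a) \<Rightarrow> (nat set \<Rightarrow>\<^sub>0 'a)" where
  "koszul_diff f v =
     (\<Sum>T\<in>Poly_Mapping.keys v. fm_scale (Poly_Mapping.lookup v T)
        (\<Sum>t\<in>T. Poly_Mapping.single (T - {t}) ((-1) ^ card {s\<in>T. s \<le> t} * f t)))"

definition koszul :: "nat \<Rightarrow> (nat \<Rightarrow> 'a::comm_ring_1) \<Rightarrow> (nat set, 'a) based_complex" where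
  "koszul m f = \<lparr> basis = (\<lambda>d. {T. T \<subseteq> {1..m} \<and> card T = d}), diff = (\<lambda>_. koszul_diff f) \<rparr>"


section \<open>Macaulay expansions\<close>

text \<open>\<open>macaulay_expansion a i j c\<close> states that \<open>a\<close> is the sum of the \<open>c k choose k\<close> for
  \<open>k = i, i - 1, \<dots>, j\<close>, with \<open>c i > c (i - 1) > \<dots> > c j \<ge> j \<ge> 1\<close>.\<close>

definition macaulay_expansion :: "nat \<Rightarrow> nat \<Rightarrow> nat \<Rightarrow> (nat \<Rightarrow> nat) \<Rightarrow> bool" where
  "macaulay_expansion a i j c \<longleftrightarrow>
     1 \<le> j \<and> j \<le> i \<and> j \<le> c j \<and> strict_mono_on {j..i} c \<and> a = (\<Sum>k=j..i. c k choose k)"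

text \<open>The expansion of a positive \<open>a\<close> exists and is unique for every \<open>i \<ge> 1\<close>, so the description
  determines its value.\<close>

definition macaulay_up :: "nat \<Rightarrow> nat \<Rightarrow> nat" where
  "macaulay_up a i =
     (if a = 0 then 0
      else (THE b. \<exists>j c. macaulay_expansion a i j c \<and> b = (\<Sum>k=j..i. c k choose Suc k)))"

end

theory Submission
  imports Defs "HOL-Library.Nat_Bijection"
begin

text \<open>
  The theorem reduces to the Kruskal-Katona theorem for simplicial complexes: the rank sequences
  of subcomplexes of \<open>koszul m f\<close> are exactly the sequences counting the faces of each size of
  the simplicial complexes on \<open>{1..m}\<close>, the empty family of faces included.

  One inclusion is direct. If \<open>\<Delta>\<close> is a simplicial complex, then the basis elements indexed by its
  faces span a subcomplex, since the differential only deletes elements from faces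
  (\<open>simplicial_rank_seq_koszul\<close>).

  For the other inclusion, write the differential as the sum of the maps \<open>f t\<close> times the contraction
  with \<open>t\<close>. A syzygy of a regular sequence has its coefficients in the ideal of the sequence, and
  this ideal consists of polynomials without constant term because the \<open>f t\<close> are homogeneous
  nonunits. Hence, after all polynomials are replaced by their constant coefficients, the single
  equation saying that a subcomplex is closed under the differential splits into \<open>m\<close> equations: the
  image of the subcomplex in the exterior algebra over the field is closed under each
  contraction separately (\<open>contraction_residue_image\<close>). This image has the same dimensions as
  the ranks, because the inclusions split. In an order on sets in which deleting a common element
  preserves comparisons, the leading set of a contraction is the leading set with one element
  deleted, so the leading sets form a simplicial complex with the same numbers
  (\<open>koszul_rank_seq_simplicial\<close>).

  The Kruskal-Katona theorem is proved in a form without binomial expansions. The \<open>colex_rank\<close> of a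
  \<open>k\<close>-set is its position among all \<open>k\<close>-subsets of \<open>\<nat>\<close> in the colexicographic order; for a fixed
  set, deleting the minimum gives the largest rank among the sets in its shadow. So the statement
  that initial segments have the smallest shadows becomes: if a \<open>(k + 1)\<close>-set \<open>D\<close> has rank below the
  size of a family, then \<open>D - {Min D}\<close> has rank below the size of the shadow of that family
  (\<open>kruskal_katona\<close>). The link with Macaulay's numbers is equally short: \<open>a\<^sup>(\<^sup>i\<^sup>)\<close> is
  characterised by the equivalence that \<open>D - {Min D}\<close> has rank below \<open>a\<close> if and only if \<open>D\<close> has rank
  below \<open>a\<^sup>(\<^sup>i\<^sup>)\<close>, for all \<open>(i + 1)\<close>-sets \<open>D\<close> (\<open>macaulay_up_colex\<close>). Together they bound the
  rank sequences, and initial segments of the colexicographic order realise every sequence within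
  the bounds.
\<close>

section \<open>The colexicographic rank of a finite set\<close>

text \<open>For \<open>A = {t\<^sub>1 < \<dots> < t\<^sub>k}\<close> this is \<open>(t\<^sub>1 choose 1) + \<dots> + (t\<^sub>k choose k)\<close>, the combinatorial number
  system: the number of \<open>k\<close>-subsets of \<open>\<nat>\<close> that precede \<open>A\<close> in the colexicographic order.\<close>
definition colex_rank :: "nat set \<Rightarrow> nat" where
  "colex_rank A = (\<Sum>t\<in>A. t choose card {s\<in>A. s \<le> t})"

definition drop_min :: "nat set \<Rightarrow> nat set" where
  "drop_min A = A - {Min A}"

lemma colex_rank_empty [simp]: "colex_rank {} = 0"
  by (simp add: colex_rank_def)

lemma colex_rank_insert_top:
  assumes "finite B" "B \<subseteq> {..<M}"
  shows "colex_rank (insert M B) = (M choose Suc (card B)) + colex_rank B"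
proof -
  have M: "M \<notin> B" using assms by auto
  have "{s \<in> insert M B. s \<le> M} = insert M B" using assms by auto
  moreover have "{s \<in> insert M B. s \<le> t} = {s \<in> B. s \<le> t}" if "t \<in> B" for t
    using that assms by auto
  ultimately show ?thesis
    using M assms by (simp add: colex_rank_def)
qed

text \<open>Most facts about ranks are proved by induction from the top: the largest element contributes
  one binomial coefficient, and the remaining set has a rank of the same kind.\<close>
lemma set_split_top:
  fixes A :: "nat set"
  assumes "card A = Suc k"
  obtains M B where "A = insert M B" "finite B" "B \<subseteq> {..<M}" "card B = k" "M \<notin> B"
proof -
  have fin: "finite A" and ne: "A \<noteq> {}" using assms by (auto intro: card_ge_0_finite)
  have "A - {Max A} \<subseteq> {..<Max A}"
    using fin by (auto simp: order_less_le)
  moreover have "A = insert (Max A) (A - {Max A})" using fin ne by (simp add: insert_absorb)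
  moreover have "card (A - {Max A}) = k" using fin ne assms by simp
  ultimately show ?thesis using that fin by blast
qed

lemma drop_min_insert_top:
  assumes "finite B" "B \<subseteq> {..<M}" "B \<noteq> {}"
  shows "drop_min (insert M B) = insert M (drop_min B)"
proof -
  have "Min B < M" using assms by (meson Min_in lessThan_iff subsetD)
  moreover have "Min (insert M B) = min M (Min B)" using assms by (intro Min_insert) auto
  ultimately show ?thesis by (auto simp: drop_min_def)
qed

lemma drop_min_subset: "drop_min B \<subseteq> B"
  by (auto simp: drop_min_def)

lemma finite_drop_min [simp]: "finite B \<Longrightarrow> finite (drop_min B)"
  by (simp add: drop_min_def)

lemma card_drop_min: "card B = Suc k \<Longrightarrow> card (drop_min B) = k"
  by (metis Min_in card.empty card_Diff_singleton card_ge_0_finite diff_Suc_1 drop_min_def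
      nat.distinct(1) zero_less_Suc)

lemma drop_min_singleton [simp]: "drop_min {x} = {}"
  by (simp add: drop_min_def)

lemma colex_rank_drop_min_insert_top:
  assumes "finite B" "B \<subseteq> {..<M}" "card B = Suc k"
  shows "colex_rank (drop_min (insert M B)) = (M choose Suc k) + colex_rank (drop_min B)"
proof -
  have "drop_min (insert M B) = insert M (drop_min B)"
    using assms by (intro drop_min_insert_top) auto
  moreover have "colex_rank (insert M (drop_min B)) = (M choose Suc k) + colex_rank (drop_min B)"
    using assms drop_min_subset[of B] card_drop_min[OF assms(3)]
    by (subst colex_rank_insert_top) auto
  ultimately show ?thesis by simp
qed

lemma colex_rank_less:
  assumes "A \<subseteq> {..<M}" "card A = k"
  shows "colex_rank A < M choose k"
  using assms
proof (induction k arbitrary: A M)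
  case 0
  then show ?case
    using finite_subset[OF 0(1)] by simp
next
  case (Suc k)
  obtain N B where NB: "A = insert N B" "finite B" "B \<subseteq> {..<N}" "card B = k"
    using set_split_top[OF Suc.prems(2)] by metis
  have "colex_rank A = (N choose Suc k) + colex_rank B"
    using NB by (simp add: colex_rank_insert_top)
  also have "\<dots> < (N choose Suc k) + (N choose k)"
    using Suc.IH NB by simp
  also have "\<dots> = Suc N choose Suc k" by simp
  also have "\<dots> \<le> M choose Suc k"
    using Suc.prems(1) NB(1) by (intro binomial_right_mono) auto
  finally show ?case .
qed

text \<open>The rank respects the colexicographic order: among sets of equal size, the larger maximum wins,
  because all the sets with a smaller maximum fit below the leading binomial coefficient.\<close>

lemma colex_rank_less_if_top_less:
  assumes "finite B" "B \<subseteq> {..<M}" "card B = k"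
    and "finite B'" "B' \<subseteq> {..<M'}" "card B' = k" and "M < M'"
  shows "colex_rank (insert M B) < colex_rank (insert M' B')"
proof -
  have "M \<notin> B" using assms(2) by auto
  then have "colex_rank (insert M B) < M' choose Suc k"
    using assms by (intro colex_rank_less) auto
  also have "\<dots> \<le> colex_rank (insert M' B')"
    using assms by (simp add: colex_rank_insert_top)
  finally show ?thesis .
qed

lemma colex_rank_inj:
  assumes "card A = k" "card A' = k" "finite A" "finite A'" "colex_rank A = colex_rank A'"
  shows "A = A'"
  using assms
proof (induction k arbitrary: A A')
  case 0
  then show ?case by simp
next
  case (Suc k)
  obtain M B where A: "A = insert M B" "finite B" "B \<subseteq> {..<M}" "card B = k"
    using set_split_top[OF Suc.prems(1)] by metis
  obtain M' B' where A': "A' = insert M' B'" "finite B'" "B' \<subseteq> {..<M'}" "card B' = k"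
    using set_split_top[OF Suc.prems(2)] by metis
  have "M = M'"
    using colex_rank_less_if_top_less A A' Suc.prems(5) by (metis less_irrefl_nat linorder_neqE_nat)
  then have "colex_rank B = colex_rank B'"
    using A A' Suc.prems(5) by (simp add: colex_rank_insert_top)
  then show ?case using Suc.IH A A' \<open>M = M'\<close> by blast
qed

text \<open>Injectivity suffices, because the two finite sets have the same size.\<close>
lemma colex_rank_bij:
  "bij_betw colex_rank {A. A \<subseteq> {..<M} \<and> card A = k} {..<M choose k}"
proof -
  let ?S = "{A. A \<subseteq> {..<M} \<and> card A = k}"
  have inj: "inj_on colex_rank ?S"
    by (rule inj_onI) (metis (mono_tags) CollectD colex_rank_inj finite_lessThan finite_subset)
  have sub: "colex_rank ` ?S \<subseteq> {..<M choose k}"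
    by (auto intro: colex_rank_less)
  have "card (colex_rank ` ?S) = M choose k"
    using inj n_subsets[of "{..<M}" k] by (simp add: card_image)
  then have "colex_rank ` ?S = {..<M choose k}"
    using sub by (intro card_subset_eq) auto
  then show ?thesis using inj by (simp add: bij_betw_def)
qed

lemma less_binomial_add: "a < (a + Suc k) choose Suc k"
  by (induction a) (auto intro: le_less_trans simp: Suc_le_eq)

lemma colex_rank_surj:
  obtains A where "finite A" "card A = Suc k" "colex_rank A = a"
proof -
  have "a \<in> colex_rank ` {A. A \<subseteq> {..<a + Suc k} \<and> card A = Suc k}"
    using colex_rank_bij[of "a + Suc k" "Suc k"] less_binomial_add[of a k]
    by (simp add: bij_betw_def)
  then show ?thesis using that finite_subset by blast
qed

definition colex_segment :: "nat \<Rightarrow> nat \<Rightarrow> nat set set" where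
  "colex_segment k a = {A. finite A \<and> card A = k \<and> colex_rank A < a}"

lemma colex_segment_bij: "bij_betw colex_rank (colex_segment (Suc k) a) {..<a}"
proof -
  have "inj_on colex_rank (colex_segment (Suc k) a)"
    by (rule inj_onI) (metis (mono_tags) CollectD colex_rank_inj colex_segment_def)
  moreover have "colex_rank ` colex_segment (Suc k) a = {..<a}"
  proof
    show "{..<a} \<subseteq> colex_rank ` colex_segment (Suc k) a"
    proof
      fix x assume "x \<in> {..<a}"
      moreover obtain A where "finite A" "card A = Suc k" "colex_rank A = x"
        by (rule colex_rank_surj)
      ultimately show "x \<in> colex_rank ` colex_segment (Suc k) a"
        by (auto simp: colex_segment_def)
    qed
  qed (auto simp: colex_segment_def)
  ultimately show ?thesis by (simp add: bij_betw_def)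
qed

lemma card_colex_segment [simp]: "card (colex_segment (Suc k) a) = a"
  and finite_colex_segment [simp]: "finite (colex_segment (Suc k) a)"
  using bij_betw_same_card[OF colex_segment_bij] bij_betw_finite[OF colex_segment_bij] by auto

text \<open>In contrapositive form: deleting minima is weakly monotone in the colexicographic order. The
  shadow of an initial segment is therefore governed by its last member.\<close>
lemma colex_rank_mono_drop_min:
  assumes "card D = Suc k" "card D' = Suc k"
    and "colex_rank (drop_min D') < colex_rank (drop_min D)"
  shows "colex_rank D' < colex_rank D"
  using assms
proof (induction k arbitrary: D D')
  case 0
  then show ?case by (auto simp: card_Suc_eq)
next
  case (Suc k)
  obtain M B where D: "D = insert M B" "finite B" "B \<subseteq> {..<M}" "card B = Suc k"
    using set_split_top[OF Suc.prems(1)] by metis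
  obtain M' B' where D': "D' = insert M' B'" "finite B'" "B' \<subseteq> {..<M'}" "card B' = Suc k"
    using set_split_top[OF Suc.prems(2)] by metis
  have dD: "drop_min D = insert M (drop_min B)" and dD': "drop_min D' = insert M' (drop_min B')"
    using drop_min_insert_top[of B M] drop_min_insert_top[of B' M'] D D' by fastforce+
  have "\<not> M < M'"
  proof
    assume "M < M'"
    then have "colex_rank (drop_min D) < colex_rank (drop_min D')"
      unfolding dD dD' using D D' drop_min_subset
      by (intro colex_rank_less_if_top_less[where k = k]) (auto intro: card_drop_min subset_trans)
    then show False using Suc.prems(3) by simp
  qed
  then consider "M' < M" | "M = M'" by linarith
  then show ?case
  proof cases
    case 1
    then show ?thesis using D D' by (auto intro!: colex_rank_less_if_top_less)
  next
    case 2
    then have "colex_rank (drop_min B') < colex_rank (drop_min B)"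
      using Suc.prems(3) D D' by (simp add: colex_rank_drop_min_insert_top)
    then have "colex_rank B' < colex_rank B" using Suc.IH D D' by blast
    then show ?thesis using 2 D D' by (simp add: colex_rank_insert_top)
  qed
qed

text \<open>Deleting the minimum leaves the largest elements in place, so it gives the last set of the
  shadow of a single set.\<close>
lemma colex_rank_delete_le_drop_min:
  assumes "card A = Suc k" "x \<in> A"
  shows "colex_rank (A - {x}) \<le> colex_rank (drop_min A)"
  using assms
proof (induction k arbitrary: A)
  case 0
  then show ?case by (auto simp: card_Suc_eq)
next
  case (Suc k)
  obtain M B where A: "A = insert M B" "finite B" "B \<subseteq> {..<M}" "card B = Suc k" "M \<notin> B"
    using set_split_top[OF Suc.prems(1)] by metis
  have r: "colex_rank (drop_min A) = (M choose Suc k) + colex_rank (drop_min B)"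
    using A by (simp add: colex_rank_drop_min_insert_top)
  show ?case
  proof (cases "x = M")
    case True
    then have "colex_rank (A - {x}) < M choose Suc k"
      using A by (auto intro: colex_rank_less)
    then show ?thesis using r by simp
  next
    case False
    then have x: "x \<in> B" "A - {x} = insert M (B - {x})" using A Suc.prems by auto
    have "colex_rank (insert M (B - {x})) = (M choose Suc (card (B - {x}))) + colex_rank (B - {x})"
      using A by (intro colex_rank_insert_top) auto
    then have "colex_rank (A - {x}) = (M choose Suc k) + colex_rank (B - {x})"
      using A x by simp
    then show ?thesis using r Suc.IH[OF A(4) x(1)] by simp
  qed
qed

text \<open>Pascal's rule, summed over the set. Each binomial coefficient \<open>t\<^sub>i + 1 choose i\<close> splits into
  \<open>t\<^sub>i choose i\<close> and \<open>t\<^sub>i choose (i - 1)\<close>; the latter form the rank of the set without its minimum,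
  except that the minimum itself contributes \<open>t\<^sub>1 choose 0 = 1\<close>. This identity is the only
  arithmetic behind the induction step of the Kruskal-Katona theorem.\<close>
lemma colex_rank_Suc_image:
  assumes "card B = Suc k"
  shows "colex_rank (Suc ` B) = colex_rank B + colex_rank (drop_min B) + 1"
  using assms
proof (induction k arbitrary: B)
  case 0
  then obtain x where "B = {x}" by (auto simp: card_Suc_eq)
  moreover have "{s. s = y \<and> s \<le> y} = {y}" for y :: nat by auto
  ultimately show ?case by (simp add: colex_rank_def)
next
  case (Suc k)
  obtain M C where B: "B = insert M C" "finite C" "C \<subseteq> {..<M}" "card C = Suc k" "M \<notin> C"
    using set_split_top[OF Suc.prems(1)] by metis
  have "colex_rank (Suc ` B) = (Suc M choose Suc (Suc k)) + colex_rank (Suc ` C)"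
  proof -
    have "colex_rank (insert (Suc M) (Suc ` C)) = (Suc M choose Suc (card (Suc ` C))) + colex_rank (Suc ` C)"
      using B by (intro colex_rank_insert_top) auto
    then show ?thesis using B by (simp add: card_image)
  qed
  also have "\<dots> = (M choose Suc (Suc k)) + (M choose Suc k)
      + (colex_rank C + colex_rank (drop_min C) + 1)"
    using Suc.IH B by simp
  finally show ?case
    using B by (simp add: colex_rank_insert_top colex_rank_drop_min_insert_top)
qed

lemma drop_min_Suc_image:
  assumes "finite B" "B \<noteq> {}"
  shows "drop_min (Suc ` B) = Suc ` drop_min B"
proof -
  have "Min (Suc ` B) = Suc (Min B)"
    using assms by (simp add: mono_Min_commute[OF mono_Suc])
  then show ?thesis by (auto simp: drop_min_def)
qed

lemma drop_min_insert_0: "finite B \<Longrightarrow> drop_min (insert 0 (Suc ` B)) = Suc ` B"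
proof -
  assume "finite B"
  then have "Min (insert 0 (Suc ` B)) = 0" by (intro Min_eqI) auto
  then show ?thesis by (auto simp: drop_min_def)
qed


section \<open>Shadows and shifting\<close>

definition shadow :: "'a set set \<Rightarrow> 'a set set" where
  "shadow \<G> = {A - {x} | A x. A \<in> \<G> \<and> x \<in> A}"

lemma shadow_iff: "B \<in> shadow \<G> \<longleftrightarrow> (\<exists>x. x \<notin> B \<and> insert x B \<in> \<G>)"
proof
  assume "B \<in> shadow \<G>"
  then show "\<exists>x. x \<notin> B \<and> insert x B \<in> \<G>"
    by (auto simp: shadow_def insert_absorb)
next
  assume "\<exists>x. x \<notin> B \<and> insert x B \<in> \<G>"
  then obtain x where "x \<notin> B" "insert x B \<in> \<G>" by blast
  then show "B \<in> shadow \<G>"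
    unfolding shadow_def by (intro CollectI exI[of _ "insert x B"] exI[of _ x]) auto
qed

lemma shadow_eq_UN: "shadow \<G> = (\<Union>A\<in>\<G>. (\<lambda>x. A - {x}) ` A)"
  by (auto simp: shadow_def)

lemma finite_shadow:
  assumes "finite \<G>" "\<And>A. A \<in> \<G> \<Longrightarrow> finite A"
  shows "finite (shadow \<G>)"
  using assms by (auto simp: shadow_eq_UN)

text \<open>The compression of Erdos, Ko and Rado. A member keeps its place when the replacement of \<open>j\<close> by
  \<open>v\<close> would collide with another member, which keeps the size of the family.\<close>
definition shift :: "'a \<Rightarrow> 'a \<Rightarrow> 'a set set \<Rightarrow> 'a set set" where
  "shift v j \<G> = (\<lambda>A. if j \<in> A \<and> v \<notin> A \<and> insert v (A - {j}) \<notin> \<G> then insert v (A - {j}) else A) ` \<G>"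

text \<open>On the pairs of sets exchanged by \<open>j\<close> and \<open>v\<close>, shifting puts as many members as possible on the
  side of \<open>v\<close>.\<close>
lemma shift_iff:
  assumes "v \<noteq> j"
  shows "B \<in> shift v j \<G> \<longleftrightarrow>
    (if j \<in> B \<and> v \<notin> B then B \<in> \<G> \<and> insert v (B - {j}) \<in> \<G>
     else if v \<in> B \<and> j \<notin> B then B \<in> \<G> \<or> insert j (B - {v}) \<in> \<G>
     else B \<in> \<G>)" (is "_ \<longleftrightarrow> ?R")
proof
  assume "B \<in> shift v j \<G>"
  then obtain A where A: "A \<in> \<G>"
    "B = (if j \<in> A \<and> v \<notin> A \<and> insert v (A - {j}) \<notin> \<G> then insert v (A - {j}) else A)"
    by (auto simp: shift_def)
  show ?R
  proof (cases "j \<in> A \<and> v \<notin> A \<and> insert v (A - {j}) \<notin> \<G>")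
    case True
    then have "insert j (insert v (A - {j}) - {v}) = A" by auto
    then show ?thesis using True A assms by auto
  next
    case False
    then show ?thesis using A by auto
  qed
next
  assume R: ?R
  show "B \<in> shift v j \<G>"
  proof (cases "B \<in> \<G>")
    case True
    then show ?thesis using R unfolding shift_def
      by (intro image_eqI[of _ _ B]) (auto split: if_splits)
  next
    case False
    then have *: "v \<in> B" "j \<notin> B" "insert j (B - {v}) \<in> \<G>"
      using R by (auto split: if_splits)
    then have "insert v (insert j (B - {v}) - {j}) = B" by auto
    then show ?thesis using * False assms unfolding shift_def
      by (intro image_eqI[of _ _ "insert j (B - {v})"]) auto
  qed
qed

lemma card_shift: "v \<noteq> j \<Longrightarrow> card (shift v j \<G>) = card \<G>"
  unfolding shift_def
proof (rule card_image, rule inj_onI)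
  fix A B
  assume "v \<noteq> j" and A: "A \<in> \<G>" and B: "B \<in> \<G>"
    and eq: "(if j \<in> A \<and> v \<notin> A \<and> insert v (A - {j}) \<notin> \<G> then insert v (A - {j}) else A) =
      (if j \<in> B \<and> v \<notin> B \<and> insert v (B - {j}) \<notin> \<G> then insert v (B - {j}) else B)"
  let ?moved = "\<lambda>A. j \<in> A \<and> v \<notin> A \<and> insert v (A - {j}) \<notin> \<G>"
  have undo: "C = insert j (insert v (C - {j}) - {v})" if "?moved C" for C
    using that by blast
  consider "?moved A" "?moved B" | "?moved A" "\<not> ?moved B" | "\<not> ?moved A" "?moved B"
    | "\<not> ?moved A" "\<not> ?moved B" by blast
  then show "A = B"
  proof cases
    case 1
    then have "insert v (A - {j}) = insert v (B - {j})" using eq by simp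
    then show ?thesis using undo[OF 1(1)] undo[OF 1(2)] by simp
  qed (use A B eq in \<open>simp_all split: if_splits\<close>)
qed

text \<open>Shifting does not enlarge the shadow. The three cases are the positions of a shadow set relative
  to \<open>j\<close> and \<open>v\<close>; in each of them the element missing from the shadow set may itself be \<open>j\<close> or \<open>v\<close>.\<close>

lemma shadow_shift_subset:
  assumes "v \<noteq> j"
  shows "shadow (shift v j \<G>) \<subseteq> shift v j (shadow \<G>)"
proof
  fix B assume "B \<in> shadow (shift v j \<G>)"
  then obtain x where x: "x \<notin> B" "insert x B \<in> shift v j \<G>" by (auto simp: shadow_iff)
  let ?A = "insert x B"
  have sh: "C \<in> shadow \<G>" if "y \<notin> C" "insert y C \<in> \<G>" for y C
    using that by (auto simp: shadow_iff)
  consider "j \<in> B" "v \<notin> B" | "v \<in> B" "j \<notin> B" | "(j \<in> B) = (v \<in> B)" by blast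
  then show "B \<in> shift v j (shadow \<G>)"
  proof cases
    case 1
    have "B \<in> shadow \<G> \<and> insert v (B - {j}) \<in> shadow \<G>"
    proof (cases "x = v")
      case True
      then have "?A \<in> \<G>" using x 1 shift_iff[OF assms, of ?A] by auto
      moreover have "insert j (insert v (B - {j})) = ?A" using 1 True by auto
      ultimately show ?thesis using sh[of x B] sh[of j "insert v (B - {j})"] x assms by auto
    next
      case False
      then have "?A \<in> \<G>" "insert v (?A - {j}) \<in> \<G>"
        using x 1 shift_iff[OF assms, of ?A] by auto
      moreover have "insert v (?A - {j}) = insert x (insert v (B - {j}))" using x 1 by auto
      ultimately show ?thesis using sh[of x B] sh[of x "insert v (B - {j})"] x False by auto
    qed
    then show ?thesis using 1 shift_iff[OF assms] by auto
  next
    case 2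
    have "B \<in> shadow \<G> \<or> insert j (B - {v}) \<in> shadow \<G>"
    proof (cases "x = j")
      case True
      then have "?A \<in> \<G>" using x 2 shift_iff[OF assms, of ?A] by auto
      then show ?thesis using sh x by blast
    next
      case False
      then have "?A \<in> \<G> \<or> insert j (?A - {v}) \<in> \<G>"
        using x 2 shift_iff[OF assms, of ?A] by auto
      moreover have "insert j (?A - {v}) = insert x (insert j (B - {v}))" using x 2 by auto
      ultimately show ?thesis using sh[of x B] sh[of x "insert j (B - {v})"] x False by auto
    qed
    then show ?thesis using 2 shift_iff[OF assms] by auto
  next
    case 3
    have "B \<in> shadow \<G>"
    proof (cases "x = v")
      case True
      then have "?A \<in> \<G> \<or> insert j (?A - {v}) \<in> \<G>" "j \<notin> B"
        using x 3 shift_iff[OF assms, of ?A] by (auto split: if_splits)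
      moreover have "?A - {v} = B" using True x by auto
      ultimately show ?thesis using sh[of x B] sh[of j B] x by auto
    next
      case False
      then have "?A \<in> \<G>"
        using x 3 shift_iff[OF assms, of ?A] by (auto split: if_splits)
      then show ?thesis using sh x by blast
    qed
    then show ?thesis using 3 shift_iff[OF assms] by auto
  qed
qed

lemma shift_uniform:
  assumes "v \<in> V" "j \<in> V" "v \<noteq> j" "\<G> \<subseteq> {A. A \<subseteq> V \<and> card A = Suc k}" "finite V"
  shows "shift v j \<G> \<subseteq> {A. A \<subseteq> V \<and> card A = Suc k}"
proof
  fix B assume "B \<in> shift v j \<G>"
  then obtain A where A: "A \<in> \<G>" "B = A \<or> (j \<in> A \<and> v \<notin> A \<and> B = insert v (A - {j}))"
    unfolding shift_def by (auto split: if_splits)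
  have "A \<subseteq> V" "card A = Suc k" using A assms by auto
  moreover from this have "finite A" by (auto intro: card_ge_0_finite)
  ultimately show "B \<in> {A. A \<subseteq> V \<and> card A = Suc k}"
    using A assms by auto
qed

text \<open>Among the uniform families of the given size with a shadow that is not larger, one with the most
  members containing \<open>v\<close> is stable under every shift towards \<open>v\<close>: a shift that changed it would
  produce a further member containing \<open>v\<close>.\<close>
lemma exists_shifted:
  assumes "finite V" "v \<in> V" "\<G> \<subseteq> {A. A \<subseteq> V \<and> card A = Suc k}"
  obtains \<H> where "\<H> \<subseteq> {A. A \<subseteq> V \<and> card A = Suc k}" "card \<H> = card \<G>"
    "card (shadow \<H>) \<le> card (shadow \<G>)"
    "\<And>A j. A \<in> \<H> \<Longrightarrow> v \<notin> A \<Longrightarrow> j \<in> A \<Longrightarrow> insert v (A - {j}) \<in> \<H>"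
proof -
  let ?U = "{A. A \<subseteq> V \<and> card A = Suc k}"
  have finU: "finite ?U" using assms(1) by simp
  define P where "P \<H> \<longleftrightarrow> \<H> \<subseteq> ?U \<and> card \<H> = card \<G> \<and> card (shadow \<H>) \<le> card (shadow \<G>)"
    for \<H>
  define w where "w \<H> = card {A \<in> \<H>. v \<in> A}" for \<H> :: "'a set set"
  have "P \<G>" using assms by (simp add: P_def)
  moreover have "\<forall>\<H>. P \<H> \<longrightarrow> w \<H> < Suc (card ?U)"
  proof (intro allI impI)
    fix \<H> assume "P \<H>"
    then have "{A \<in> \<H>. v \<in> A} \<subseteq> ?U" by (auto simp: P_def)
    then show "w \<H> < Suc (card ?U)" using card_mono[OF finU] by (simp add: w_def less_Suc_eq_le)
  qed
  ultimately obtain \<H> where H: "P \<H>" and max: "\<And>\<K>. P \<K> \<Longrightarrow> w \<K> \<le> w \<H>"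
    using ex_has_greatest_nat[of P \<G> w] by blast
  have HU: "\<H> \<subseteq> ?U" using H by (simp add: P_def)
  have finH: "finite \<H>" using HU finU finite_subset by blast
  have finmem: "finite A" if "A \<in> \<H>" for A using that HU assms(1) finite_subset by blast
  have "insert v (A - {j}) \<in> \<H>" if A: "A \<in> \<H>" "v \<notin> A" "j \<in> A" for A j
  proof (rule ccontr)
    assume n: "insert v (A - {j}) \<notin> \<H>"
    have vj: "v \<noteq> j" using A by auto
    have j: "j \<in> V" using A HU by auto
    have "card (shadow (shift v j \<H>)) \<le> card (shift v j (shadow \<H>))"
      using shadow_shift_subset[OF vj] finite_shadow[OF finH finmem]
      by (intro card_mono) (auto simp: shift_def)
    then have "P (shift v j \<H>)"
      using H shift_uniform[OF assms(2) j vj HU assms(1)] by (simp add: P_def card_shift[OF vj])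
    then have "w (shift v j \<H>) \<le> w \<H>" by (rule max)
    moreover have "{A \<in> \<H>. v \<in> A} \<subset> {A \<in> shift v j \<H>. v \<in> A}"
    proof
      show "{A \<in> \<H>. v \<in> A} \<subseteq> {A \<in> shift v j \<H>. v \<in> A}"
        using shift_iff[OF vj] by auto
      have "insert v (A - {j}) \<in> shift v j \<H>" using A n by (auto simp: shift_def)
      then show "{A \<in> \<H>. v \<in> A} \<noteq> {A \<in> shift v j \<H>. v \<in> A}" using n by blast
    qed
    then have "w \<H> < w (shift v j \<H>)"
      unfolding w_def using finH by (intro psubset_card_mono) (auto simp: shift_def)
    ultimately show False by simp
  qed
  then show ?thesis using that[of \<H>] H by (simp add: P_def)
qed


section \<open>The Kruskal-Katona theorem\<close>

text \<open>The numerical core of the induction. Here \<open>y\<close> and \<open>z\<close> are the sizes of the link of a vertex and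
  of the shadow of the link, and \<open>x\<close> is the number of members avoiding the vertex. Shift the
  initial segments with \<open>y\<close> and \<open>x\<close> members up by one and cone the former with the new vertex 0. The
  resulting family has \<open>x + y\<close> members, and deleting the minimum from any of them leaves the shifted
  copy of a set of rank below \<open>y\<close>, whose rank is below \<open>y + z\<close> by the identity of Pascal type. If
  the conclusion failed for \<open>D\<close>, all these \<open>x + y\<close> sets would have rank below that of \<open>D\<close>.\<close>
lemma colex_rank_drop_min_cone:
  assumes link: "\<And>B. finite B \<Longrightarrow> card B = Suc k \<Longrightarrow> colex_rank B < y \<Longrightarrow> colex_rank (drop_min B) < z"
    and del: "\<And>D. finite D \<Longrightarrow> card D = Suc (Suc k) \<Longrightarrow> colex_rank D < x \<Longrightarrow> colex_rank (drop_min D) < y"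
    and D: "finite D" "card D = Suc (Suc k)" "colex_rank D < x + y"
  shows "colex_rank (drop_min D) < y + z"
proof (rule ccontr)
  assume n: "\<not> colex_rank (drop_min D) < y + z"
  define \<C> where "\<C> = (\<lambda>B. insert 0 (Suc ` B)) ` colex_segment (Suc k) y"
  define \<E> where "\<E> = (`) Suc ` colex_segment (Suc (Suc k)) x"
  have SB: "colex_rank (Suc ` B) < y + z" if "finite B" "card B = Suc k" "colex_rank B < y" for B
    using link[OF that] colex_rank_Suc_image[OF that(2)] that(3) by simp
  have dm: "colex_rank (drop_min A) < y + z \<and> finite A \<and> card A = Suc (Suc k)"
    if "A \<in> \<C> \<union> \<E>" for A
  proof (cases "A \<in> \<C>")
    case True
    then obtain B where B: "A = insert 0 (Suc ` B)" "finite B" "card B = Suc k" "colex_rank B < y"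
      by (auto simp: \<C>_def colex_segment_def)
    then show ?thesis using SB[OF B(2-4)] by (auto simp: drop_min_insert_0 card_image)
  next
    case False
    then obtain E where E: "A = Suc ` E" "finite E" "card E = Suc (Suc k)" "colex_rank E < x"
      using \<open>A \<in> \<C> \<union> \<E>\<close> by (auto simp: \<E>_def colex_segment_def)
    have "E \<noteq> {}" using E(3) by auto
    then show ?thesis
      using E SB[of "drop_min E"] del[OF E(2-4)] card_drop_min[OF E(3)]
      by (auto simp: drop_min_Suc_image card_image)
  qed
  have "colex_rank A < colex_rank D" if "A \<in> \<C> \<union> \<E>" for A
  proof (rule colex_rank_mono_drop_min[OF D(2)])
    show "card A = Suc (Suc k)" using dm[OF that] by (elim conjE)
    have "colex_rank (drop_min A) < y + z" using dm[OF that] by (elim conjE)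
    also have "\<dots> \<le> colex_rank (drop_min D)" using n by (simp only: not_less)
    finally show "colex_rank (drop_min A) < colex_rank (drop_min D)" .
  qed
  then have "colex_rank ` (\<C> \<union> \<E>) \<subseteq> {..<colex_rank D}" by auto
  moreover have "inj_on colex_rank (\<C> \<union> \<E>)"
  proof (rule inj_onI)
    fix A B assume "A \<in> \<C> \<union> \<E>" "B \<in> \<C> \<union> \<E>" "colex_rank A = colex_rank B"
    then show "A = B" using dm[of A] dm[of B] colex_rank_inj[of A _ B] by simp
  qed
  ultimately have "card (\<C> \<union> \<E>) \<le> colex_rank D"
    using card_inj_on_le[of colex_rank "\<C> \<union> \<E>" "{..<colex_rank D}"] by simp
  moreover have "card (\<C> \<union> \<E>) = y + x"
  proof (subst card_Un_disjoint)
    have "inj_on (\<lambda>B. insert 0 (Suc ` B)) (colex_segment (Suc k) y)"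
    proof (rule inj_onI)
      fix A B :: "nat set" assume "insert 0 (Suc ` A) = insert 0 (Suc ` B)"
      then have "Suc ` A = Suc ` B" by (metis Zero_not_Suc image_iff insert_ident)
      then show "A = B" by (simp add: inj_image_eq_iff)
    qed
    moreover have "inj_on ((`) Suc) (colex_segment (Suc (Suc k)) x)"
      by (auto intro!: inj_onI simp: inj_image_eq_iff)
    ultimately show "card \<C> + card \<E> = y + x" by (simp add: card_image \<C>_def \<E>_def)
  qed (auto simp: \<C>_def \<E>_def)
  ultimately show False using D(3) by simp
qed

text \<open>After shifting towards \<open>v\<close>, the shadow of the members avoiding \<open>v\<close> lies in the link of \<open>v\<close>. The
  full shadow contains the link and, disjointly from it, the cone over the shadow of the link. With
  the induction hypothesis for the link and for the members avoiding \<open>v\<close>, the preceding lemma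
  gives the bound.\<close>
theorem kruskal_katona:
  assumes "finite V" "\<G> \<subseteq> {A. A \<subseteq> V \<and> card A = Suc k}"
    and "finite D" "card D = Suc k" "colex_rank D < card \<G>"
  shows "colex_rank (drop_min D) < card (shadow \<G>)"
  using assms
proof (induction V arbitrary: k \<G> D rule: finite_induct)
  case empty
  then have "\<G> = {}" by auto
  then show ?case using empty.prems by simp
next
  case (insert v V)
  have finV: "finite (insert v V)" using insert.hyps(1) by simp
  obtain \<H> where H: "\<H> \<subseteq> {A. A \<subseteq> insert v V \<and> card A = Suc k}" "card \<H> = card \<G>"
    "card (shadow \<H>) \<le> card (shadow \<G>)"
    and sh: "\<And>A j. A \<in> \<H> \<Longrightarrow> v \<notin> A \<Longrightarrow> j \<in> A \<Longrightarrow> insert v (A - {j}) \<in> \<H>"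
    by (rule exists_shifted[OF finV insertI1 insert.prems(1)]) (rule that)
  have finH: "finite \<H>" and finmem: "\<And>A. A \<in> \<H> \<Longrightarrow> finite A"
  proof -
    show "finite \<H>" by (rule finite_subset[OF H(1)]) (use finV in simp)
    show "finite A" if "A \<in> \<H>" for A
    proof (rule finite_subset[OF _ finV])
      show "A \<subseteq> insert v V" using that H(1) by blast
    qed
  qed
  note finS = finite_shadow[OF finH finmem]
  have "colex_rank (drop_min D) < card (shadow \<H>)"
  proof (cases k)
    \<comment> \<open>For singletons the link of \<open>v\<close> would consist of the empty set, where ranks carry no
      information.\<close>
    case 0
    obtain A where A: "A \<in> \<H>" using insert.prems H(2) by (cases "\<H> = {}") auto
    then obtain a where "A = {a}" using H(1) 0 by (auto simp: card_Suc_eq)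
    then have "{} \<in> shadow \<H>" using A by (auto simp: shadow_iff)
    then have "0 < card (shadow \<H>)" using finS card_gt_0_iff by blast
    moreover have "drop_min D = {}" using insert.prems 0 by (auto simp: card_Suc_eq)
    ultimately show ?thesis by simp
  next
    case (Suc l)
    \<comment> \<open>\<open>L\<close> is the link of \<open>v\<close>, and \<open>E\<close> consists of the members avoiding \<open>v\<close>.\<close>
    define L where "L = (\<lambda>A. A - {v}) ` {A \<in> \<H>. v \<in> A}"
    define E where "E = {A \<in> \<H>. v \<notin> A}"
    have injL: "inj_on (\<lambda>A. A - {v}) {A \<in> \<H>. v \<in> A}" by (rule inj_onI) (metis (mono_tags, lifting) CollectD insert_Diff)
    have finL: "finite L" and finE: "finite E" using finH by (auto simp: L_def E_def)
    have cardH: "card \<H> = card E + card L"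
    proof -
      have "\<H> = E \<union> {A \<in> \<H>. v \<in> A}" by (auto simp: E_def)
      moreover have "card (E \<union> {A \<in> \<H>. v \<in> A}) = card E + card {A \<in> \<H>. v \<in> A}"
        using finH by (intro card_Un_disjoint) (auto simp: E_def)
      ultimately show ?thesis using card_image[OF injL] by (simp add: L_def)
    qed
    have LU: "L \<subseteq> {A. A \<subseteq> V \<and> card A = Suc l}"
      using H(1) Suc finmem by (auto simp: L_def)
    have EU: "E \<subseteq> {A. A \<subseteq> V \<and> card A = Suc (Suc l)}"
      using H(1) Suc by (auto simp: E_def)
    have "shadow E \<subseteq> L"
    proof
      fix B assume "B \<in> shadow E"
      then obtain A x where A: "A \<in> \<H>" "v \<notin> A" "x \<in> A" "B = A - {x}"
        by (auto simp: shadow_def E_def)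
      then have "insert v B \<in> \<H>" using sh by auto
      moreover have "insert v B - {v} = B" using A by auto
      ultimately show "B \<in> L" unfolding L_def by (intro image_eqI[of _ _ "insert v B"]) auto
    qed
    then have cE: "card (shadow E) \<le> card L" by (intro card_mono finL)
    have cS: "card L + card (shadow L) \<le> card (shadow \<H>)"
    proof -
      have vL: "v \<notin> B" if "B \<in> L" for B
        using that by (auto simp: L_def)
      have vS: "v \<notin> B" if "B \<in> shadow L" for B
        using that vL by (fastforce simp: shadow_def)
      have "L \<union> insert v ` shadow L \<subseteq> shadow \<H>"
      proof
        fix B assume "B \<in> L \<union> insert v ` shadow L"
        then consider "B \<in> L" | C where "C \<in> shadow L" "B = insert v C" by blast
        then show "B \<in> shadow \<H>"
        proof cases
          case 1
          then obtain A where "A \<in> \<H>" "v \<in> A" "B = A - {v}" by (auto simp: L_def)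
          then show ?thesis unfolding shadow_def by blast
        next
          case 2
          then obtain x where x: "x \<notin> C" "insert x C \<in> L" by (auto simp: shadow_iff)
          then obtain A where A: "A \<in> \<H>" "v \<in> A" "insert x C = A - {v}" by (auto simp: L_def)
          then have "insert x B = A" "x \<noteq> v" using 2 by auto
          then show ?thesis using A x 2 by (auto simp: shadow_iff)
        qed
      qed
      then have "card (L \<union> insert v ` shadow L) \<le> card (shadow \<H>)"
        using finS by (intro card_mono)
      moreover have "finite (shadow L)"
        using finite_shadow[OF finL] LU insert.hyps(1)
        by (metis (no_types, lifting) CollectD finite_subset subsetD)
      then have "card (L \<union> insert v ` shadow L) = card L + card (insert v ` shadow L)"
        using finL vL by (intro card_Un_disjoint) blast+
      moreover have "card (insert v ` shadow L) = card (shadow L)"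
        using vS by (intro card_image inj_onI) (metis insert_ident)
      ultimately show ?thesis by simp
    qed
    have link: "colex_rank (drop_min B) < card (shadow L)"
      if B: "finite B" "card B = Suc l" "colex_rank B < card L" for B
      by (rule insert.IH[OF LU B])
    have del: "colex_rank (drop_min B) < card L"
      if B: "finite B" "card B = Suc (Suc l)" "colex_rank B < card E" for B
      by (rule less_le_trans[OF insert.IH[OF EU B] cE])
    have cD: "card D = Suc (Suc l)" and rD: "colex_rank D < card E + card L"
      using insert.prems(3,4) Suc H(2) cardH by simp_all
    have "colex_rank (drop_min D) < card L + card (shadow L)"
      by (rule colex_rank_drop_min_cone[OF link del insert.prems(2) cD rD])
    then show ?thesis using cS by (rule less_le_trans)
  qed
  then show ?case using H(3) by (rule less_le_trans)
qed


section \<open>Macaulay expansions\<close>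

lemma macaulay_expansion_step:
  assumes "macaulay_expansion a (Suc i) j c"
  obtains "j = Suc i" "a = (c (Suc i) choose Suc i)"
  | a' where "j \<le> i" "macaulay_expansion a' i j c" "c i < c (Suc i)"
      "a = (c (Suc i) choose Suc i) + a'"
proof (cases "j = Suc i")
  case True
  then show ?thesis using assms that(1) by (simp add: macaulay_expansion_def)
next
  case False
  then have j: "1 \<le> j" "j \<le> i" "j \<le> c j" and sm: "strict_mono_on {j..Suc i} c"
    and a: "a = (\<Sum>k=j..Suc i. c k choose k)"
    using assms by (auto simp: macaulay_expansion_def)
  have "strict_mono_on {j..i} c" using sm by (auto simp: strict_mono_on_def)
  moreover have "c i < c (Suc i)" using strict_mono_onD[OF sm, of i "Suc i"] j by simp
  ultimately show ?thesis
    using that(2)[of "\<Sum>k=j..i. c k choose k"] j a by (auto simp: macaulay_expansion_def)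
qed

text \<open>The first bound says that the leading term of an expansion is chosen greedily, the second one
  that the image of the remaining terms stays below the next leading term.\<close>
lemma macaulay_expansion_bounds:
  assumes "macaulay_expansion a i j c" "c i < N"
  shows "a < N choose i" "(\<Sum>k=j..i. c k choose Suc k) \<le> N choose Suc i"
proof -
  have "a < (N choose i) \<and> (\<Sum>k=j..i. c k choose Suc k) \<le> (N choose Suc i)"
    using assms
  proof (induction i arbitrary: a N)
    case 0
    then show ?case by (auto simp: macaulay_expansion_def)
  next
    case (Suc i)
    have N: "(Suc (c (Suc i)) choose l) \<le> N choose l" for l
      using Suc.prems(2) by (intro binomial_right_mono) auto
    have pos: "j \<le> Suc i" "1 \<le> j" "j \<le> c j" using Suc.prems(1) by (auto simp: macaulay_expansion_def)
    from Suc.prems(1) show ?case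
    proof (cases rule: macaulay_expansion_step)
      case 1
      then have "0 < c (Suc i) choose i" using pos by simp
      then show ?thesis using 1 N[of "Suc i"] N[of "Suc (Suc i)"] by (simp del: zero_less_binomial_iff)
    next
      case (2 a')
      have IH: "a' < c (Suc i) choose i" "(\<Sum>k=j..i. c k choose Suc k) \<le> c (Suc i) choose Suc i"
        using Suc.IH[OF 2(2,3)] by auto
      then show ?thesis using 2 N[of "Suc i"] N[of "Suc (Suc i)"] by simp
    qed
  qed
  then show "a < N choose i" "(\<Sum>k=j..i. c k choose Suc k) \<le> N choose Suc i" by auto
qed

text \<open>The leading term comes from the maximum of the \<open>i\<close>-set whose rank is \<open>a\<close>; the expansion stops as
  soon as the remainder vanishes.\<close>
lemma macaulay_expansion_exists:
  assumes "0 < a"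
  shows "\<exists>j c. macaulay_expansion a (Suc i) j c"
  using assms
proof (induction i arbitrary: a)
  case 0
  then show ?case
    by (intro exI[of _ 1] exI[of _ "\<lambda>_. a"]) (simp add: macaulay_expansion_def strict_mono_on_def)
next
  case (Suc i)
  obtain A where A: "finite A" "card A = Suc (Suc i)" "colex_rank A = a" by (rule colex_rank_surj)
  obtain N B where NB: "A = insert N B" "finite B" "B \<subseteq> {..<N}" "card B = Suc i"
    using set_split_top[OF A(2)] by metis
  define a' where "a' = colex_rank B"
  have a: "a = (N choose Suc (Suc i)) + a'"
    using A NB by (simp add: a'_def colex_rank_insert_top)
  have a': "a' < N choose Suc i" using NB by (simp add: a'_def colex_rank_less)
  show ?case
  proof (cases "a' = 0")
    case True
    then have "Suc (Suc i) \<le> N" using a Suc.prems by (metis add_0_right binomial_eq_0_iff not_le not_less_zero)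
    then show ?thesis using True a
      by (intro exI[of _ "Suc (Suc i)"] exI[of _ "\<lambda>_. N"])
        (simp add: macaulay_expansion_def strict_mono_on_def)
  next
    case False
    then obtain j c where jc: "macaulay_expansion a' (Suc i) j c" using Suc.IH by blast
    have j: "1 \<le> j" "j \<le> Suc i" "j \<le> c j" and sm: "strict_mono_on {j..Suc i} c"
      and s: "a' = (\<Sum>k=j..Suc i. c k choose k)"
      using jc by (auto simp: macaulay_expansion_def)
    have "c (Suc i) < N"
    proof (rule ccontr)
      assume "\<not> c (Suc i) < N"
      then have "(N choose Suc i) \<le> c (Suc i) choose Suc i" by (intro binomial_right_mono) auto
      also have "\<dots> \<le> a'" using j by (simp add: s)
      finally show False using a' by simp
    qed
    moreover have "c x \<le> c (Suc i)" if "j \<le> x" "x \<le> Suc i" for x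
      using sm that by (cases "x = Suc i") (auto dest!: strict_mono_onD[of _ _ x "Suc i"] simp: less_imp_le)
    ultimately have "c x < N" if "j \<le> x" "x \<le> Suc i" for x using that by (meson le_less_trans)
    then have "strict_mono_on {j..Suc (Suc i)} (c(Suc (Suc i) := N))"
      using sm by (auto simp: strict_mono_on_def le_Suc_eq)
    moreover have "(\<Sum>k=j..Suc i. (c(Suc (Suc i) := N)) k choose k) = a'"
      unfolding s by (rule sum.cong) auto
    ultimately have "macaulay_expansion a (Suc (Suc i)) j (c(Suc (Suc i) := N))"
      using j a by (auto simp: macaulay_expansion_def)
    then show ?thesis by blast
  qed
qed

text \<open>Compare the maximum of \<open>D\<close> with the leading entry of the expansion. If they differ, both sides
  are decided by the leading binomial coefficients; if they agree, the leading terms cancel and the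
  claim for the remaining terms applies.\<close>
lemma macaulay_expansion_colex:
  assumes "macaulay_expansion a i j c" "card D = Suc i"
  shows "colex_rank (drop_min D) < a \<longleftrightarrow> colex_rank D < (\<Sum>k=j..i. c k choose Suc k)"
  using assms
proof (induction i arbitrary: a D)
  case 0
  then show ?case by (auto simp: macaulay_expansion_def)
next
  case (Suc i)
  define N where "N = c (Suc i)"
  define b where "b = (\<Sum>k=j..Suc i. c k choose Suc k)"
  obtain M B where D: "D = insert M B" "finite B" "B \<subseteq> {..<M}" "card B = Suc i" "M \<notin> B"
    using set_split_top[OF Suc.prems(2)] by metis
  have rD: "colex_rank D = (M choose Suc (Suc i)) + colex_rank B"
    and rdD: "colex_rank (drop_min D) = (M choose Suc i) + colex_rank (drop_min B)"
    using D by (simp_all add: colex_rank_insert_top colex_rank_drop_min_insert_top)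
  have up: "a < Suc N choose Suc i" "b \<le> Suc N choose Suc (Suc i)"
    unfolding b_def by (rule macaulay_expansion_bounds[OF Suc.prems(1)]; simp add: N_def)+
  have lo: "(N choose Suc i) \<le> a" "(N choose Suc (Suc i)) \<le> b"
    using Suc.prems(1) by (auto simp: macaulay_expansion_def N_def b_def)
  have mono: "(x choose l) \<le> y choose l" if "x \<le> y" for x y l :: nat
    using that by (rule binomial_right_mono)
  have cD: "card (drop_min D) = Suc i" using card_drop_min[OF Suc.prems(2)] .
  consider "M < N" | "N < M" | "M = N" by linarith
  then have "colex_rank (drop_min D) < a \<longleftrightarrow> colex_rank D < b"
  proof cases
    case 1
    then have "D \<subseteq> {..<N}" using D by auto
    then have "colex_rank D < N choose Suc (Suc i)" "colex_rank (drop_min D) < N choose Suc i"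
      using Suc.prems(2) cD drop_min_subset[of D] by (auto intro!: colex_rank_less)
    then show ?thesis using lo by simp
  next
    case 2
    then have "\<not> colex_rank (drop_min D) < a" "\<not> colex_rank D < b"
      using rD rdD up mono[of "Suc N" M "Suc i"] mono[of "Suc N" M "Suc (Suc i)"] by linarith+
    then show ?thesis by simp
  next
    case 3
    from Suc.prems(1) show ?thesis
    proof (cases rule: macaulay_expansion_step)
      case 1
      then show ?thesis using rD rdD 3 by (simp add: N_def b_def)
    next
      case (2 a')
      then show ?thesis using Suc.IH[OF 2(2) D(4)] rD rdD 3 by (simp add: N_def b_def)
    qed
  qed
  then show ?case by (simp add: b_def)
qed

text \<open>Since every natural number is the rank of some \<open>(i + 1)\<close>-set, the equivalence determines the
  value of an expansion. So all expansions of \<open>a\<close> give the same value, and the definite description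
  in \<open>macaulay_up\<close> inherits the equivalence.\<close>
theorem macaulay_up_colex:
  assumes "0 < i" "card D = Suc i"
  shows "colex_rank (drop_min D) < a \<longleftrightarrow> colex_rank D < macaulay_up a i"
proof (cases "a = 0")
  case True
  then show ?thesis by (simp add: macaulay_up_def)
next
  case False
  let ?P = "\<lambda>b. \<exists>j c. macaulay_expansion a i j c \<and> b = (\<Sum>k=j..i. c k choose Suc k)"
  obtain j c where jc: "macaulay_expansion a i j c"
    using macaulay_expansion_exists[of a "i - 1"] False assms(1) by auto
  have le: "b \<le> b'" if "?P b" "?P b'" for b b'
  proof (rule ccontr)
    assume "\<not> b \<le> b'"
    moreover obtain E where "finite E" "card E = Suc i" "colex_rank E = b'" by (rule colex_rank_surj)
    ultimately show False using macaulay_expansion_colex that by (metis less_irrefl not_le)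
  qed
  have "?P (macaulay_up a i)"
    unfolding macaulay_up_def using False jc
    by simp (rule theI2[where P = ?P]; use le in \<open>blast intro: le_antisym\<close>)
  then show ?thesis using macaulay_expansion_colex assms(2) by metis
qed

corollary kruskal_katona_macaulay:
  assumes "finite V" "\<G> \<subseteq> {A. A \<subseteq> V \<and> card A = Suc i}" "0 < i"
    and "finite \<F>" "shadow \<G> \<subseteq> \<F>"
  shows "card \<G> \<le> macaulay_up (card \<F>) i"
proof (rule ccontr)
  assume n: "\<not> card \<G> \<le> macaulay_up (card \<F>) i"
  obtain D where D: "finite D" "card D = Suc i" "colex_rank D = macaulay_up (card \<F>) i"
    by (rule colex_rank_surj)
  have "colex_rank (drop_min D) < card (shadow \<G>)"
    using n D assms by (intro kruskal_katona) auto
  also have "\<dots> \<le> card \<F>" using assms by (intro card_mono)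
  finally show False using D macaulay_up_colex[OF assms(3) D(2)] by simp
qed

lemma colex_segment_delete:
  assumes "0 < i" "b \<le> macaulay_up a i" "A \<in> colex_segment (Suc i) b" "x \<in> A"
  shows "A - {x} \<in> colex_segment i a"
proof -
  have A: "finite A" "card A = Suc i" "colex_rank A < macaulay_up a i"
    using assms(2,3) by (auto simp: colex_segment_def)
  have "colex_rank (A - {x}) \<le> colex_rank (drop_min A)"
    by (rule colex_rank_delete_le_drop_min[OF A(2) assms(4)])
  also have "\<dots> < a" using macaulay_up_colex[OF assms(1) A(2)] A(3) by simp
  finally show ?thesis using A assms(4) by (simp add: colex_segment_def)
qed

text \<open>The bound on \<open>r 1\<close> confines all segments to \<open>m\<close> vertices: a set with at least two elements has
  the same maximum as the set without its minimum, which lies in the segment one level below.\<close>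
lemma colex_segment_subset_lessThan:
  assumes "r 1 \<le> m" "\<And>i. 0 < i \<Longrightarrow> r (Suc i) \<le> macaulay_up (r i) i"
    and "A \<in> colex_segment d (r d)"
  shows "A \<subseteq> {..<m}"
  using assms(3)
proof (induction d arbitrary: A)
  case 0
  then show ?case by (auto simp: colex_segment_def)
next
  case (Suc d)
  then have A: "finite A" "card A = Suc d" "colex_rank A < r (Suc d)" by (auto simp: colex_segment_def)
  show ?case
  proof (cases d)
    case 0
    then obtain t where "A = {t}" using A(2) by (auto simp: card_Suc_eq)
    then show ?thesis using A(3) 0 assms(1) colex_rank_insert_top[of "{}" t] by simp
  next
    case (Suc e)
    obtain M B where MB: "A = insert M B" "finite B" "B \<subseteq> {..<M}" "card B = d"
      using set_split_top[OF A(2)] by metis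
    have "Min A \<in> A" using A by (intro Min_in) auto
    then have "drop_min A \<in> colex_segment d (r d)"
      unfolding drop_min_def
      using Suc.prems Suc assms(2)[of d] by (intro colex_segment_delete[of d "r (Suc d)"]) auto
    then have "drop_min A \<subseteq> {..<m}" by (rule Suc.IH)
    moreover have "M \<in> drop_min A"
      using MB Suc by (subst MB(1), subst drop_min_insert_top) auto
    ultimately have "M < m" by blast
    then show ?thesis using MB by auto
  qed
qed


section \<open>Homomorphisms of free modules and their residues\<close>

text \<open>The linear extension of a map given on the basis; every homomorphism of the ambient modules is of
  this form.\<close>
definition lin_ext :: "('b \<Rightarrow> ('c \<Rightarrow>\<^sub>0 'a)) \<Rightarrow> ('b \<Rightarrow>\<^sub>0 'a) \<Rightarrow> ('c \<Rightarrow>\<^sub>0 'a::comm_ring_1)" where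
  "lin_ext h v = (\<Sum>b\<in>Poly_Mapping.keys v. fm_scale (Poly_Mapping.lookup v b) (h b))"

lemma lookup_lin_ext:
  assumes "finite B" "Poly_Mapping.keys v \<subseteq> B"
  shows "Poly_Mapping.lookup (lin_ext h v) c =
    (\<Sum>b\<in>B. Poly_Mapping.lookup v b * Poly_Mapping.lookup (h b) c)"
proof -
  have "Poly_Mapping.lookup (lin_ext h v) c =
      (\<Sum>b\<in>Poly_Mapping.keys v. Poly_Mapping.lookup v b * Poly_Mapping.lookup (h b) c)"
    by (simp add: lin_ext_def lookup_sum lookup_fm_scale)
  also have "\<dots> = (\<Sum>b\<in>B. Poly_Mapping.lookup v b * Poly_Mapping.lookup (h b) c)"
    using assms by (intro sum.mono_neutral_left) (auto simp: in_keys_iff)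
  finally show ?thesis .
qed

lemma module_hom_lin_ext: "module_hom fm_scale fm_scale (lin_ext h)"
proof -
  have "lin_ext h (v + w) = lin_ext h v + lin_ext h w" for v w
  proof (rule poly_mapping_eqI)
    fix c
    let ?B = "Poly_Mapping.keys v \<union> Poly_Mapping.keys w"
    have "Poly_Mapping.keys (v + w) \<subseteq> ?B" by (rule Poly_Mapping.keys_add)
    then show "Poly_Mapping.lookup (lin_ext h (v + w)) c =
        Poly_Mapping.lookup (lin_ext h v + lin_ext h w) c"
      by (simp add: lookup_lin_ext[of ?B] lookup_add sum.distrib algebra_simps)
  qed
  moreover have "lin_ext h (fm_scale a v) = fm_scale a (lin_ext h v)" for a v
  proof (rule poly_mapping_eqI)
    fix c
    let ?B = "Poly_Mapping.keys v"
    have "Poly_Mapping.keys (fm_scale a v) \<subseteq> ?B" by (auto simp: in_keys_iff lookup_fm_scale)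
    then show "Poly_Mapping.lookup (lin_ext h (fm_scale a v)) c =
        Poly_Mapping.lookup (fm_scale a (lin_ext h v)) c"
      by (simp add: lookup_lin_ext[of ?B] lookup_fm_scale sum_distrib_left algebra_simps)
  qed
  ultimately show ?thesis
    by (simp add: module_hom_iff module_fm_scale)
qed

lemma fm_scale_zero [simp]: "fm_scale 0 v = 0" "fm_scale c 0 = 0"
  by (auto intro!: poly_mapping_eqI simp: lookup_fm_scale)

lemma fm_scale_one [simp]: "fm_scale 1 v = v"
  by (auto intro!: poly_mapping_eqI simp: lookup_fm_scale)

lemma fm_scale_single: "fm_scale c (Poly_Mapping.single b d) = Poly_Mapping.single b (c * d)"
  by (auto intro!: poly_mapping_eqI simp: lookup_fm_scale lookup_single when_def)

lemma lin_ext_single: "lin_ext h (Poly_Mapping.single b c) = fm_scale c (h b)"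
  by (cases "c = 0") (simp_all add: lin_ext_def)

lemma poly_mapping_expand:
  "v = (\<Sum>b\<in>Poly_Mapping.keys v. Poly_Mapping.single b (Poly_Mapping.lookup v b))"
proof (rule poly_mapping_eqI)
  fix c
  show "Poly_Mapping.lookup v c = Poly_Mapping.lookup
      (\<Sum>b\<in>Poly_Mapping.keys v. Poly_Mapping.single b (Poly_Mapping.lookup v b)) c"
    by (cases "c \<in> Poly_Mapping.keys v")
      (auto simp: lookup_sum lookup_single when_def in_keys_iff)
qed

lemma module_hom_eq_lin_ext:
  assumes "module_hom fm_scale fm_scale \<phi>"
  shows "\<phi> = lin_ext (\<lambda>b. \<phi> (Poly_Mapping.single b 1))"
proof
  fix v
  interpret module_hom fm_scale fm_scale \<phi> by (rule assms)
  have "\<phi> v = (\<Sum>b\<in>Poly_Mapping.keys v. \<phi> (fm_scale (Poly_Mapping.lookup v b) (Poly_Mapping.single b 1)))"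
    by (subst poly_mapping_expand) (simp add: sum fm_scale_single)
  then show "\<phi> v = lin_ext (\<lambda>b. \<phi> (Poly_Mapping.single b 1)) v"
    by (simp only: lin_ext_def scale)
qed

definition const_coeff :: "('n, 'k::zero) mpoly \<Rightarrow> 'k" where
  "const_coeff p = Poly_Mapping.lookup p 0"

lemma const_coeff_simps [simp]:
  fixes p q :: "('n, 'k::comm_ring_1) mpoly"
  shows "const_coeff (0 :: ('n, 'k) mpoly) = 0"
  "const_coeff (p + q) = const_coeff p + const_coeff q"
  "const_coeff (p - q) = const_coeff p - const_coeff q"
  "const_coeff (- p) = - const_coeff p"
  "const_coeff (Poly_Mapping.single 0 c :: ('n, 'k) mpoly) = c"
  by (simp_all add: const_coeff_def lookup_add lookup_minus)

lemma const_coeff_one [simp]: "const_coeff (1 :: ('n, 'k::zero_neq_one) mpoly) = 1"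
  by (simp add: const_coeff_def lookup_one)

lemma const_coeff_mult [simp]:
  "const_coeff (p * q) = const_coeff p * const_coeff (q :: ('n, 'k::comm_ring_1) mpoly)"
proof -
  have "(0 = l + (r :: 'n \<Rightarrow>\<^sub>0 nat)) \<longleftrightarrow> l = 0 \<and> r = 0" for l r
    by (metis add_0_right add_eq_0_iff_both_eq_0 lookup_add lookup_zero poly_mapping_eqI)
  then have "(Poly_Mapping.lookup q r when 0 = l + r) = ((Poly_Mapping.lookup q r when l = 0) when r = 0)"
    for l r by (auto simp: when_def)
  then show ?thesis
    by (simp add: const_coeff_def times_poly_mapping.rep_eq prod_fun_def mult_when)
qed

lemma const_coeff_sum [simp]: "const_coeff (sum g A) = (\<Sum>a\<in>A. const_coeff (g a :: ('n, 'k::comm_ring_1) mpoly))"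
  by (induction A rule: infinite_finite_induct) auto

lemma const_coeff_sign [simp]:
  "const_coeff ((- 1) ^ n :: ('n, 'k::comm_ring_1) mpoly) = (- 1) ^ n"
  by (induction n) auto

text \<open>Reduction modulo the ideal generated by the variables.\<close>
definition residue :: "('b \<Rightarrow>\<^sub>0 ('n, 'k) mpoly) \<Rightarrow> ('b \<Rightarrow>\<^sub>0 'k::comm_ring_1)" where
  "residue v = Poly_Mapping.map const_coeff v"

lemma lookup_residue: "Poly_Mapping.lookup (residue v) b = const_coeff (Poly_Mapping.lookup v b)"
  by (simp add: residue_def Poly_Mapping.map.rep_eq when_def)

lemma residue_zero [simp]: "residue 0 = 0"
  and residue_diff: "residue (v - w) = residue v - residue w"
  by (auto intro!: poly_mapping_eqI
      simp: lookup_residue lookup_add lookup_minus lookup_fm_scale)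

text \<open>A homomorphism maps multiples of the variables to such multiples, so it descends to residues.\<close>
lemma residue_hom_eq_0:
  assumes "module_hom fm_scale fm_scale \<phi>" "residue v = 0"
  shows "residue (\<phi> v) = 0"
proof (rule poly_mapping_eqI)
  fix c
  have "const_coeff (Poly_Mapping.lookup v b) = 0" for b
    using assms(2) by (metis lookup_residue lookup_zero)
  then show "Poly_Mapping.lookup (residue (\<phi> v)) c = Poly_Mapping.lookup 0 c"
    by (subst module_hom_eq_lin_ext[OF assms(1)]) (simp add: lookup_residue lookup_lin_ext[OF _ order_refl])
qed

lemma vector_space_fm_scale: "vector_space (fm_scale :: 'k::field \<Rightarrow> ('b \<Rightarrow>\<^sub>0 'k) \<Rightarrow> _)"
  by standard (auto intro!: poly_mapping_eqI simp: lookup_fm_scale lookup_add algebra_simps)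

global_interpretation fm: vector_space "fm_scale :: 'k::field \<Rightarrow> ('b \<Rightarrow>\<^sub>0 'k) \<Rightarrow> _"
  by (rule vector_space_fm_scale)

lemma independent_image:
  fixes x :: "'i \<Rightarrow> ('b \<Rightarrow>\<^sub>0 'k::field)"
  assumes "finite I" and ind: "\<And>u. (\<Sum>i\<in>I. fm_scale (u i) (x i)) = 0 \<Longrightarrow> \<forall>i\<in>I. u i = 0"
  shows "inj_on x I" "fm.independent (x ` I)"
proof -
  show inj: "inj_on x I"
  proof (rule inj_onI, rule ccontr)
    fix a b assume ab: "a \<in> I" "b \<in> I" "x a = x b" "a \<noteq> b"
    define u where "u i = (if i = a then 1 else if i = b then - 1 else 0 :: 'k)" for i
    have "(\<Sum>i\<in>I. fm_scale (u i) (x i)) = (\<Sum>i\<in>{a, b}. fm_scale (u i) (x i))"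
      using ab assms(1) by (intro sum.mono_neutral_right) (auto simp: u_def)
    also have "\<dots> = 0" using ab by (simp add: u_def)
    finally show False using ind[of u] ab by (auto simp: u_def)
  qed
  show "fm.independent (x ` I)"
  proof
    assume "fm.dependent (x ` I)"
    then obtain u where u: "\<exists>v\<in>x ` I. u v \<noteq> 0" "(\<Sum>v\<in>x ` I. fm_scale (u v) v) = 0"
      using fm.dependent_finite[of "x ` I"] assms(1) by auto
    then have "(\<Sum>i\<in>I. fm_scale (u (x i)) (x i)) = 0" by (simp add: sum.reindex[OF inj])
    then show False using ind[of "\<lambda>i. u (x i)"] u(1) by auto
  qed
qed

definition residue_image :: "'b set \<Rightarrow> (('b \<Rightarrow>\<^sub>0 ('n, 'k) mpoly) \<Rightarrow> ('c \<Rightarrow>\<^sub>0 ('n, 'k) mpoly)) \<Rightarrow>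
    ('c \<Rightarrow>\<^sub>0 'k::field) set" where
  "residue_image B \<phi> = residue ` \<phi> ` free_module B"

text \<open>A splitting of \<open>\<phi>\<close> descends to the residues as well. So the residue map of \<open>\<phi>\<close> is injective, and
  the residues of the images of the basis elements form a basis of the image.\<close>
lemma residue_image_basis:
  fixes \<phi> :: "('b \<Rightarrow>\<^sub>0 ('n, 'k::field) mpoly) \<Rightarrow> ('c \<Rightarrow>\<^sub>0 ('n, 'k) mpoly)"
  assumes "split_injective B C \<phi>" "finite B"
  obtains X where "fm.independent X" "card X = card B" "residue_image B \<phi> = fm.span X"
proof -
  obtain \<psi> where hom: "module_hom fm_scale fm_scale \<phi>" and hom': "module_hom fm_scale fm_scale \<psi>"
    and inv: "\<And>v. v \<in> free_module B \<Longrightarrow> \<psi> (\<phi> v) = v"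
    using assms(1) by (auto simp: split_injective_def free_hom_def)
  interpret \<phi>: module_hom fm_scale fm_scale \<phi> by (rule hom)
  define x where "x b = residue (\<phi> (Poly_Mapping.single b 1))" for b
  have img: "residue (\<phi> v) = (\<Sum>b\<in>B. fm_scale (const_coeff (Poly_Mapping.lookup v b)) (x b))"
    if "v \<in> free_module B" for v
  proof (rule poly_mapping_eqI)
    fix c
    have "Poly_Mapping.lookup (\<phi> v) c =
        (\<Sum>b\<in>B. Poly_Mapping.lookup v b * Poly_Mapping.lookup (\<phi> (Poly_Mapping.single b 1)) c)"
      using that assms(2)
      by (subst module_hom_eq_lin_ext[OF hom]) (simp add: lookup_lin_ext free_module_def)
    then show "Poly_Mapping.lookup (residue (\<phi> v)) c = Poly_Mapping.lookup
        (\<Sum>b\<in>B. fm_scale (const_coeff (Poly_Mapping.lookup v b)) (x b)) c"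
      by (simp add: lookup_residue lookup_sum lookup_fm_scale x_def)
  qed
  have lift: "\<exists>v \<in> (free_module B :: ('b \<Rightarrow>\<^sub>0 ('n, 'k) mpoly) set).
      \<forall>b\<in>B. const_coeff (Poly_Mapping.lookup v b) = u b" for u :: "'b \<Rightarrow> 'k"
  proof -
    let ?v = "\<Sum>b\<in>B. Poly_Mapping.single b (Poly_Mapping.single (0 :: 'n \<Rightarrow>\<^sub>0 nat) (u b))"
    have l: "Poly_Mapping.lookup ?v b = (if b \<in> B then Poly_Mapping.single 0 (u b) else 0)" for b
      using assms(2) by (simp add: lookup_sum lookup_single when_def)
    have "?v \<in> free_module B" by (auto simp: free_module_def in_keys_iff l split: if_splits)
    moreover have "\<forall>b\<in>B. const_coeff (Poly_Mapping.lookup ?v b) = u b" by (simp add: l)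
    ultimately show ?thesis by blast
  qed
  have ind: "\<forall>b\<in>B. u b = 0" if "(\<Sum>b\<in>B. fm_scale (u b) (x b)) = 0" for u
  proof -
    obtain v :: "'b \<Rightarrow>\<^sub>0 ('n, 'k) mpoly"
      where v: "v \<in> free_module B" "\<And>b. b \<in> B \<Longrightarrow> const_coeff (Poly_Mapping.lookup v b) = u b"
      using lift[of u] by blast
    then have "residue (\<phi> v) = 0" using img[OF v(1)] that by simp
    then have "residue (\<psi> (\<phi> v)) = 0" by (rule residue_hom_eq_0[OF hom'])
    then have "residue v = 0" using inv v(1) by simp
    then show ?thesis using v(2) by (metis lookup_residue lookup_zero)
  qed
  have "residue_image B \<phi> = fm.span (x ` B)"
  proof
    show "residue_image B \<phi> \<subseteq> fm.span (x ` B)"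
      unfolding residue_image_def
      by (auto simp: img intro!: fm.span_sum fm.span_scale fm.span_base[OF imageI])
    show "fm.span (x ` B) \<subseteq> residue_image B \<phi>"
    proof
      fix w assume "w \<in> fm.span (x ` B)"
      then obtain u where "w = (\<Sum>y\<in>x ` B. fm_scale (u y) y)"
        using assms(2) by (auto simp: fm.span_finite)
      then have w: "w = (\<Sum>b\<in>B. fm_scale (u (x b)) (x b))"
        using sum.reindex[OF independent_image(1)[of B x, OF assms(2) ind]] by simp
      obtain v :: "'b \<Rightarrow>\<^sub>0 ('n, 'k) mpoly"
      where v: "v \<in> free_module B" "\<And>b. b \<in> B \<Longrightarrow> const_coeff (Poly_Mapping.lookup v b) = u (x b)"
        using lift[of "\<lambda>b. u (x b)"] by blast
      then have "w = residue (\<phi> v)" using w img[OF v(1)] by simp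
      then show "w \<in> residue_image B \<phi>" using v(1) by (simp add: residue_image_def)
    qed
  qed
  then show ?thesis
    using that[of "x ` B"] independent_image[of B x, OF assms(2) ind] by (simp add: card_image)
qed


section \<open>Leading terms\<close>

text \<open>The analogue of the leading monomials of an ideal, for the order on indices given by the weight
  \<open>e\<close>.\<close>
definition leading :: "('b \<Rightarrow> nat) \<Rightarrow> ('b \<Rightarrow>\<^sub>0 'k::zero) set \<Rightarrow> 'b set" where
  "leading e W = {T. \<exists>w\<in>W. T \<in> Poly_Mapping.keys w \<and> (\<forall>U\<in>Poly_Mapping.keys w. e U \<le> e T)}"

text \<open>Gaussian elimination: elements with distinct leading indices are independent, and choosing one
  for each leading index gives a spanning set, because subtracting a multiple of the right one lowers
  the largest weight in the support.\<close>
lemma card_leading: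
  fixes X :: "('b \<Rightarrow>\<^sub>0 'k::field) set"
  assumes "fm.independent X" "finite B" "inj_on e B"
    and keys: "\<And>w. w \<in> fm.span X \<Longrightarrow> Poly_Mapping.keys w \<subseteq> B"
  shows "card (leading e (fm.span X)) = card X"
proof -
  define L where "L = leading e (fm.span X)"
  have LB: "L \<subseteq> B" using keys by (auto simp: L_def leading_def)
  then have finL: "finite L" using assms(2) finite_subset by blast
  have "\<forall>T\<in>L. \<exists>w\<in>fm.span X. T \<in> Poly_Mapping.keys w \<and> (\<forall>U\<in>Poly_Mapping.keys w. e U \<le> e T)"
    by (auto simp: L_def leading_def)
  then obtain y where y: "\<And>T. T \<in> L \<Longrightarrow> y T \<in> fm.span X"
    and T_y: "\<And>T. T \<in> L \<Longrightarrow> T \<in> Poly_Mapping.keys (y T)"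
    and top_y: "\<And>T U. T \<in> L \<Longrightarrow> U \<in> Poly_Mapping.keys (y T) \<Longrightarrow> e U \<le> e T"
    by metis
  have ind: "\<forall>T\<in>L. u T = 0" if u: "(\<Sum>T\<in>L. fm_scale (u T) (y T)) = 0" for u
  proof (rule ccontr)
    assume "\<not> (\<forall>T\<in>L. u T = 0)"
    then have M: "finite {T \<in> L. u T \<noteq> 0}" "{T \<in> L. u T \<noteq> 0} \<noteq> {}" using finL by auto
    then have "Max (e ` {T \<in> L. u T \<noteq> 0}) \<in> e ` {T \<in> L. u T \<noteq> 0}" by (intro Max_in) auto
    then obtain T where T: "T \<in> L" "u T \<noteq> 0" "e T = Max (e ` {T \<in> L. u T \<noteq> 0})" by force
    have max: "e U \<le> e T" if "U \<in> L" "u U \<noteq> 0" for U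
      unfolding T(3) using M(1) that by (intro Max_ge) auto
    have "u U * Poly_Mapping.lookup (y U) T = 0" if "U \<in> L" "U \<noteq> T" for U
    proof (cases "u U = 0")
      case False
      then have "e U \<le> e T" using max that(1) by blast
      moreover have "e U \<noteq> e T" using assms(3) LB T(1) that by (meson inj_onD subsetD)
      ultimately have "T \<notin> Poly_Mapping.keys (y U)" using top_y[OF that(1), of T] by auto
      then show ?thesis by (simp add: in_keys_iff)
    qed simp
    then have "(\<Sum>U\<in>L - {T}. u U * Poly_Mapping.lookup (y U) T) = 0"
      by (intro sum.neutral) auto
    then have "(\<Sum>U\<in>L. u U * Poly_Mapping.lookup (y U) T) = u T * Poly_Mapping.lookup (y T) T"
      by (simp add: sum.remove[OF finL T(1)])
    moreover have "(\<Sum>U\<in>L. u U * Poly_Mapping.lookup (y U) T) = 0"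
      using arg_cong[OF u, of "\<lambda>w. Poly_Mapping.lookup w T"]
      by (simp add: lookup_sum lookup_fm_scale)
    ultimately show False using T T_y by (simp add: in_keys_iff)
  qed
  have step: "w \<in> fm.span (y ` L)"
    if "w \<in> fm.span X" "\<And>U. U \<in> Poly_Mapping.keys w \<Longrightarrow> e U < n" for w n
    using that
  proof (induction n arbitrary: w)
    case 0
    then have "w = 0" by (metis all_not_in_conv keys_eq_empty not_less_zero)
    then show ?case by (simp add: fm.span_zero)
  next
    case (Suc n)
    show ?case
    proof (cases "\<exists>T\<in>Poly_Mapping.keys w. e T = n")
      case False
      then show ?thesis using Suc by (metis less_antisym)
    next
      case True
      then obtain T where T: "T \<in> Poly_Mapping.keys w" "e T = n" by blast
      then have TL: "T \<in> L" using Suc.prems unfolding L_def leading_def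
        by (auto simp: less_Suc_eq_le intro!: bexI[of _ w])
      define c where "c = Poly_Mapping.lookup w T / Poly_Mapping.lookup (y T) T"
      define w' where "w' = w - fm_scale c (y T)"
      have w': "w' \<in> fm.span X"
        unfolding w'_def using Suc.prems(1) y[OF TL] by (intro fm.span_diff fm.span_scale)
      have "Poly_Mapping.lookup w' T = 0"
        using T_y[OF TL] by (simp add: w'_def c_def lookup_minus lookup_fm_scale in_keys_iff)
      then have T': "T \<notin> Poly_Mapping.keys w'" by (simp add: in_keys_iff)
      have "e U < n" if U: "U \<in> Poly_Mapping.keys w'" for U
      proof -
        have "U \<in> Poly_Mapping.keys w \<or> U \<in> Poly_Mapping.keys (y T)"
          using U by (auto simp: w'_def in_keys_iff lookup_minus lookup_fm_scale)
        then have "e U \<le> n" using Suc.prems(2) top_y[OF TL] T(2) by (auto simp: less_Suc_eq_le)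
        moreover have "e U \<noteq> e T"
          using assms(3) U T' keys[OF w'] keys[OF Suc.prems(1)] T(1) by (metis inj_onD subsetD)
        ultimately show ?thesis using T(2) by simp
      qed
      then have "w' \<in> fm.span (y ` L)" using Suc.IH w' by blast
      moreover have "fm_scale c (y T) \<in> fm.span (y ` L)"
        using TL by (intro fm.span_scale fm.span_base) auto
      ultimately have "w' + fm_scale c (y T) \<in> fm.span (y ` L)" by (rule fm.span_add)
      then show ?thesis by (simp add: w'_def)
    qed
  qed
  have "fm.span X \<subseteq> fm.span (y ` L)"
  proof
    fix w assume w: "w \<in> fm.span X"
    have "e U < Suc (Max (e ` Poly_Mapping.keys w))" if "U \<in> Poly_Mapping.keys w" for U
      using that by (simp add: le_imp_less_Suc)
    then show "w \<in> fm.span (y ` L)" using step w by blast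
  qed
  moreover have "fm.span (y ` L) \<subseteq> fm.span X"
    using y by (intro fm.span_minimal) (auto intro: fm.subspace_span)
  ultimately have "fm.span (y ` L) = fm.span X" by blast
  then have "card (y ` L) = card X"
    using independent_image(2)[of L y, OF finL ind] assms(1) by (metis fm.dim_eq_card)
  then show ?thesis using card_image[OF independent_image(1)[of L y, OF finL ind]] by (simp add: L_def)
qed


section \<open>Syzygies of regular sequences\<close>

lemma ideal_gen_combination:
  fixes f :: "'i \<Rightarrow> 'a::comm_ring_1"
  assumes "finite A" "g \<in> ideal_gen (f ` A)"
  obtains h where "g = (\<Sum>i\<in>A. f i * h i)"
proof -
  let ?S = "{g. \<exists>h. g = (\<Sum>i\<in>A. f i * h i)}"
  have "module.subspace (*) ?S"
    unfolding module.subspace_def[OF module_times]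
  proof (intro conjI ballI allI)
    show "0 \<in> ?S" by (intro CollectI exI[of _ "\<lambda>_. 0"]) simp
  next
    fix x y assume "x \<in> ?S" "y \<in> ?S"
    then obtain h h' where "x = (\<Sum>i\<in>A. f i * h i)" "y = (\<Sum>i\<in>A. f i * h' i)" by blast
    then show "x + y \<in> ?S"
      by (intro CollectI exI[of _ "\<lambda>i. h i + h' i"]) (simp add: distrib_left sum.distrib)
  next
    fix c x assume "x \<in> ?S"
    then obtain h where "x = (\<Sum>i\<in>A. f i * h i)" by blast
    then show "c * x \<in> ?S"
      by (intro CollectI exI[of _ "\<lambda>i. c * h i"]) (simp add: sum_distrib_left mult.left_commute)
  qed
  moreover have "f ` A \<subseteq> ?S"
  proof
    fix x assume "x \<in> f ` A"
    then obtain i where i: "i \<in> A" "x = f i" by blast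
    have "(\<Sum>l\<in>A. f l * (if l = i then 1 else 0)) = f i"
      using i assms(1) by (simp add: sum.delta' if_distrib cong: if_cong)
    then show "x \<in> ?S" using i by (intro CollectI exI[of _ "\<lambda>l. if l = i then 1 else 0"]) simp
  qed
  ultimately have "ideal_gen (f ` A) \<subseteq> ?S"
    unfolding ideal_gen_def by (intro module.span_minimal[OF module_times])
  then show ?thesis using assms(2) that by blast
qed

text \<open>The coefficient of \<open>f (m + 1)\<close> in a syzygy lies in the ideal of the earlier members, since
  \<open>f (m + 1)\<close> is a nonzerodivisor modulo that ideal. Writing it as a combination \<open>\<Sum>i. f i * h i\<close>
  and moving each \<open>f (m + 1) * h i\<close> to the coefficient of \<open>f i\<close> gives a syzygy of the shorter
  sequence.\<close>
lemma regular_syzygy_in_ideal: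
  fixes f :: "nat \<Rightarrow> 'a::comm_ring_1"
  assumes "\<forall>i\<in>{1..m}. \<forall>g. f i * g \<in> ideal_gen (f ` {1..<i}) \<longrightarrow> g \<in> ideal_gen (f ` {1..<i})"
    and "(\<Sum>i\<in>{1..m}. f i * g i) = 0" "i \<in> {1..m}"
  shows "g i \<in> ideal_gen (f ` {1..m})"
  using assms
proof (induction m arbitrary: g i)
  case 0
  then show ?case by simp
next
  case (Suc m)
  have mono: "ideal_gen (f ` {1..m}) \<subseteq> ideal_gen (f ` {1..Suc m})"
    unfolding ideal_gen_def by (intro module.span_mono[OF module_times] image_mono) auto
  have base: "f l * c \<in> ideal_gen (f ` {1..M})" if "l \<in> {1..M}" for l c M
    unfolding ideal_gen_def using that
    by (subst mult.commute) (intro module.span_scale[OF module_times] module.span_base[OF module_times], auto)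
  have "{1..Suc m} = insert (Suc m) {1..m}" by auto
  then have s: "f (Suc m) * g (Suc m) + (\<Sum>i\<in>{1..m}. f i * g i) = 0"
    using Suc.prems(2) by simp
  have "(\<Sum>i\<in>{1..m}. f i * g i) \<in> ideal_gen (f ` {1..m})"
    using base unfolding ideal_gen_def by (intro module.span_sum[OF module_times]) auto
  then have "- (\<Sum>i\<in>{1..m}. f i * g i) \<in> ideal_gen (f ` {1..m})"
    unfolding ideal_gen_def by (rule module.span_neg[OF module_times])
  with s have "f (Suc m) * g (Suc m) \<in> ideal_gen (f ` {1..m})"
    unfolding eq_neg_iff_add_eq_0[symmetric] by (rule ssubst)
  then have gm: "g (Suc m) \<in> ideal_gen (f ` {1..m})"
    using Suc.prems(1) by (metis atLeastAtMost_iff atLeastLessThanSuc_atLeastAtMost le_add1 order_refl plus_1_eq_Suc)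
  then obtain h where h: "g (Suc m) = (\<Sum>i\<in>{1..m}. f i * h i)"
    by (rule ideal_gen_combination[OF finite_atLeastAtMost])
  have "(\<Sum>i\<in>{1..m}. f i * (g i + f (Suc m) * h i)) = 0"
    using s unfolding h by (simp add: distrib_left sum.distrib sum_distrib_left mult.left_commute add.commute)
  then have gh: "g l + f (Suc m) * h l \<in> ideal_gen (f ` {1..m})" if "l \<in> {1..m}" for l
    using Suc.IH[of "\<lambda>i. g i + f (Suc m) * h i" l] Suc.prems(1) that by auto
  show ?case
  proof (cases "i = Suc m")
    case True
    then show ?thesis using gm mono by blast
  next
    case False
    then have "g i + f (Suc m) * h i \<in> ideal_gen (f ` {1..Suc m})" using gh mono Suc.prems(3) by auto
    moreover have "f (Suc m) * h i \<in> ideal_gen (f ` {1..Suc m})" by (rule base) simp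
    ultimately have "g i + f (Suc m) * h i - f (Suc m) * h i \<in> ideal_gen (f ` {1..Suc m})"
      unfolding ideal_gen_def by (rule module.span_diff[OF module_times])
    then show ?thesis by simp
  qed
qed

text \<open>A homogeneous polynomial with a nonzero constant term is a nonzero constant, hence a unit, and
  then the ideal of the sequence would be everything.\<close>
lemma const_coeff_regular_sequence:
  fixes f :: "nat \<Rightarrow> ('n, 'k::field) mpoly"
  assumes "homogeneous (f i)" "regular_sequence m f" "i \<in> {1..m}"
  shows "const_coeff (f i) = 0"
proof (rule ccontr)
  assume c: "const_coeff (f i) \<noteq> 0"
  then have "0 \<in> Poly_Mapping.keys (f i)" by (simp add: const_coeff_def in_keys_iff)
  moreover obtain d where d: "\<And>t. t \<in> Poly_Mapping.keys (f i) \<Longrightarrow> monom_degree t = d"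
    using assms(1) by (auto simp: homogeneous_def)
  ultimately have deg: "monom_degree t = 0" if "t \<in> Poly_Mapping.keys (f i)" for t
    using that by (metis (no_types, lifting) keys_zero monom_degree_def sum.empty)
  have "t = 0" if "t \<in> Poly_Mapping.keys (f i)" for t
  proof (rule poly_mapping_eqI)
    fix x
    have "\<forall>x\<in>Poly_Mapping.keys t. Poly_Mapping.lookup t x = 0"
      using deg[OF that] by (simp add: monom_degree_def)
    then show "Poly_Mapping.lookup t x = Poly_Mapping.lookup 0 x"
      by (auto simp: in_keys_iff)
  qed
  then have "f i = Poly_Mapping.single 0 (const_coeff (f i))"
    by (intro poly_mapping_eqI) (auto simp: const_coeff_def lookup_single when_def in_keys_iff)
  then have "Poly_Mapping.single 0 (inverse (const_coeff (f i))) * f i = 1"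
    using c by (metis (no_types, lifting) add.right_neutral left_inverse mult_single single_one)
  moreover have "Poly_Mapping.single 0 (inverse (const_coeff (f i))) * f i \<in> ideal_gen (f ` {1..m})"
    unfolding ideal_gen_def using assms(3)
    by (intro module.span_scale[OF module_times] module.span_base[OF module_times]) auto
  ultimately show False using assms(2) by (simp add: regular_sequence_def)
qed

lemma const_coeff_ideal_gen:
  fixes f :: "nat \<Rightarrow> ('n, 'k::field) mpoly"
  assumes "\<And>i. i \<in> A \<Longrightarrow> const_coeff (f i) = 0" "g \<in> ideal_gen (f ` A)" "finite A"
  shows "const_coeff g = 0"
proof -
  obtain h where "g = (\<Sum>i\<in>A. f i * h i)" using ideal_gen_combination[OF assms(3,2)] .
  then show ?thesis using assms(1) by simp
qed


section \<open>Contractions and the Koszul differential\<close>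

text \<open>The part of the differential that deletes \<open>t\<close>, with its sign and without the factor \<open>f t\<close>. On the
  exterior algebra this is, up to sign, the contraction with the \<open>t\<close>-th dual basis vector.\<close>
definition contraction :: "nat \<Rightarrow> (nat set \<Rightarrow>\<^sub>0 'a::comm_ring_1) \<Rightarrow> (nat set \<Rightarrow>\<^sub>0 'a)" where
  "contraction t = lin_ext (\<lambda>T. if t \<in> T
     then Poly_Mapping.single (T - {t}) ((- 1) ^ card {s\<in>T. s \<le> t}) else 0)"

lemma lookup_contraction:
  "Poly_Mapping.lookup (contraction t v) U = (if t \<in> U then 0
     else (- 1) ^ card {s\<in>insert t U. s \<le> t} * Poly_Mapping.lookup v (insert t U))"
proof -
  let ?h = "\<lambda>T. if t \<in> T then Poly_Mapping.single (T - {t}) ((- 1) ^ card {s\<in>T. s \<le> t}) else 0 :: nat set \<Rightarrow>\<^sub>0 'a"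
  have "Poly_Mapping.lookup (?h T) U =
      (if t \<notin> U \<and> T = insert t U then (- 1) ^ card {s\<in>insert t U. s \<le> t} else 0)" for T
    by (auto simp: lookup_single when_def insert_absorb)
  then have "Poly_Mapping.lookup (contraction t v) U = (\<Sum>T\<in>insert (insert t U) (Poly_Mapping.keys v).
      Poly_Mapping.lookup v T * (if t \<notin> U \<and> T = insert t U then (- 1) ^ card {s\<in>insert t U. s \<le> t} else 0))"
    unfolding contraction_def by (subst lookup_lin_ext[of "insert (insert t U) (Poly_Mapping.keys v)"]) auto
  also have "\<dots> = (\<Sum>T\<in>{insert t U}.
      Poly_Mapping.lookup v T * (if t \<notin> U \<and> T = insert t U then (- 1) ^ card {s\<in>insert t U. s \<le> t} else 0))"
    by (intro sum.mono_neutral_right) auto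
  finally show ?thesis by (simp add: mult.commute)
qed

lemma module_hom_contraction: "module_hom fm_scale fm_scale (contraction t)"
  unfolding contraction_def by (rule module_hom_lin_ext)

lemma residue_contraction: "residue (contraction t v) = contraction t (residue v)"
  by (rule poly_mapping_eqI) (simp add: lookup_residue lookup_contraction)

lemma keys_contraction:
  "U \<in> Poly_Mapping.keys (contraction t v) \<longleftrightarrow> t \<notin> U \<and> insert t U \<in> Poly_Mapping.keys v"
  by (simp add: in_keys_iff lookup_contraction minus_one_power_iff)

lemma contraction_self: "contraction t (contraction t v) = 0"
  by (rule poly_mapping_eqI) (simp add: lookup_contraction)

lemma contraction_anticommute:
  assumes "s \<noteq> t"
  shows "contraction s (contraction t v) = - contraction t (contraction s v)"
proof -
  have *: "contraction s (contraction t v) = - contraction t (contraction s v)" if "s < t" for s t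
  proof (rule poly_mapping_eqI)
    fix U
    show "Poly_Mapping.lookup (contraction s (contraction t v)) U =
        Poly_Mapping.lookup (- contraction t (contraction s v)) U"
    proof (cases "s \<in> U \<or> t \<in> U")
      case False
      have "{x \<in> insert s (insert t U). x \<le> s} = {x \<in> insert s U. x \<le> s}" using that by auto
      moreover have "{x \<in> insert t (insert s U). x \<le> t} = insert s {x \<in> insert t U. x \<le> t}"
        using that by auto
      then have "card {x \<in> insert t (insert s U). x \<le> t} = Suc (card {x \<in> insert t U. x \<le> t})"
        using False that by simp
      ultimately show ?thesis
        using False that by (simp add: lookup_contraction insert_commute)
    qed (use that in \<open>auto simp: lookup_contraction\<close>)
  qed
  show ?thesis
    using *[of s t] *[of t s] assms by (cases "s < t") auto
qed

lemma koszul_diff_eq_lin_ext: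
  "koszul_diff f = lin_ext (\<lambda>T. \<Sum>t\<in>T. Poly_Mapping.single (T - {t}) ((-1) ^ card {s\<in>T. s \<le> t} * f t))"
  by (rule ext) (simp add: koszul_diff_def lin_ext_def)

lemma koszul_diff_eq_contractions:
  assumes "Poly_Mapping.keys v \<subseteq> Pow {1..m}"
  shows "koszul_diff f v = (\<Sum>t\<in>{1..m}. fm_scale (f t) (contraction t v))"
proof (rule poly_mapping_eqI)
  fix U
  let ?h = "\<lambda>t T. if t \<in> T then Poly_Mapping.single (T - {t}) ((- 1) ^ card {s\<in>T. s \<le> t}) else 0"
  let ?K = "Poly_Mapping.keys v"
  have inner: "Poly_Mapping.lookup (\<Sum>t\<in>T. Poly_Mapping.single (T - {t}) ((-1) ^ card {s\<in>T. s \<le> t} * f t)) U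
      = (\<Sum>t\<in>{1..m}. f t * Poly_Mapping.lookup (?h t T) U)" if "T \<in> ?K" for T
  proof -
    have "T \<subseteq> {1..m}" using that assms by auto
    then have "(\<Sum>t\<in>{1..m}. f t * Poly_Mapping.lookup (?h t T) U) = (\<Sum>t\<in>T. f t * Poly_Mapping.lookup (?h t T) U)"
      by (intro sum.mono_neutral_right) auto
    also have "\<dots> = (\<Sum>t\<in>T. Poly_Mapping.lookup (Poly_Mapping.single (T - {t}) ((-1) ^ card {s\<in>T. s \<le> t} * f t)) U)"
      by (intro sum.cong) (auto simp: lookup_single when_def)
    finally show ?thesis by (simp add: lookup_sum)
  qed
  have "Poly_Mapping.lookup (koszul_diff f v) U = (\<Sum>T\<in>?K. Poly_Mapping.lookup v T * (\<Sum>t\<in>{1..m}. f t * Poly_Mapping.lookup (?h t T) U))"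
    by (simp add: koszul_diff_eq_lin_ext lookup_lin_ext[of ?K] inner cong: sum.cong)
  also have "\<dots> = (\<Sum>t\<in>{1..m}. \<Sum>T\<in>?K. Poly_Mapping.lookup v T * (f t * Poly_Mapping.lookup (?h t T) U))"
    unfolding sum_distrib_left by (rule sum.swap)
  also have "\<dots> = (\<Sum>t\<in>{1..m}. f t * Poly_Mapping.lookup (contraction t v) U)"
    unfolding contraction_def by (subst lookup_lin_ext[of ?K]) (auto simp: sum_distrib_left intro!: sum.cong)
  finally show "Poly_Mapping.lookup (koszul_diff f v) U =
      Poly_Mapping.lookup (\<Sum>t\<in>{1..m}. fm_scale (f t) (contraction t v)) U"
    by (simp add: lookup_sum lookup_fm_scale)
qed

lemma antisymmetric_sum_eq_0:
  fixes F :: "'i \<Rightarrow> 'i \<Rightarrow> 'a::ab_group_add"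
  assumes "finite A" "\<And>t. F t t = 0" "\<And>s t. s \<noteq> t \<Longrightarrow> F s t = - F t s"
  shows "(\<Sum>s\<in>A. \<Sum>t\<in>A. F s t) = 0"
  using assms(1)
proof (induction A rule: finite_induct)
  case (insert a A)
  have "(\<Sum>s\<in>A. F s a) = (\<Sum>s\<in>A. - F a s)"
    using insert.hyps by (intro sum.cong) (auto intro: assms(3))
  then show ?case
    using insert assms(2) by (simp add: sum.distrib sum_negf)
qed simp

lemma koszul_diff_koszul_diff:
  assumes "Poly_Mapping.keys v \<subseteq> Pow {1..m}"
  shows "koszul_diff f (koszul_diff f v) = 0"
proof -
  have "Poly_Mapping.lookup (koszul_diff f v) U = 0" if "U \<notin> Pow {1..m}" for U
  proof -
    have "insert t U \<notin> Poly_Mapping.keys v" for t using that assms by blast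
    then have "Poly_Mapping.lookup (contraction t v) U = 0" for t
      by (simp add: lookup_contraction in_keys_iff)
    then show ?thesis
      by (simp add: koszul_diff_eq_contractions[OF assms] lookup_sum lookup_fm_scale)
  qed
  then have k: "Poly_Mapping.keys (koszul_diff f v) \<subseteq> Pow {1..m}"
    by (metis in_keys_iff subsetI)
  have "koszul_diff f (koszul_diff f v) =
      (\<Sum>s\<in>{1..m}. fm_scale (f s) (contraction s (\<Sum>t\<in>{1..m}. fm_scale (f t) (contraction t v))))"
    by (subst koszul_diff_eq_contractions[OF k]) (simp only: koszul_diff_eq_contractions[OF assms])
  also have "\<dots> = (\<Sum>s\<in>{1..m}. \<Sum>t\<in>{1..m}. fm_scale (f s * f t) (contraction s (contraction t v)))"
  proof (rule sum.cong[OF refl])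
    fix s
    interpret c: module_hom fm_scale fm_scale "contraction s" by (rule module_hom_contraction)
    have "contraction s (\<Sum>t\<in>{1..m}. fm_scale (f t) (contraction t v)) =
        (\<Sum>t\<in>{1..m}. fm_scale (f t) (contraction s (contraction t v)))"
      by (simp add: c.sum c.scale)
    then show "fm_scale (f s) (contraction s (\<Sum>t\<in>{1..m}. fm_scale (f t) (contraction t v))) =
        (\<Sum>t\<in>{1..m}. fm_scale (f s * f t) (contraction s (contraction t v)))"
      by (simp add: c.m1.scale_sum_right)
  qed
  also have "\<dots> = 0"
  proof (rule antisymmetric_sum_eq_0)
    show "fm_scale (f s * f t) (contraction s (contraction t v)) =
        - fm_scale (f t * f s) (contraction t (contraction s v))" if "s \<noteq> t" for s t
      unfolding contraction_anticommute[OF that]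
      by (intro poly_mapping_eqI) (simp add: lookup_fm_scale mult.commute)
  qed (simp_all add: contraction_self)
  finally show ?thesis .
qed


section \<open>Rank sequences of subcomplexes\<close>

text \<open>The weight \<open>set_encode T = (\<Sum>t\<in>T. 2 ^ t)\<close> is injective on finite sets, and adding a new
  element \<open>t\<close> raises it by \<open>2 ^ t\<close>. So the sets containing \<open>t\<close> keep their order when \<open>t\<close> is
  deleted.\<close>
lemma leading_contraction:
  assumes "T \<in> leading set_encode W" "t \<in> T"
    and fin: "\<And>w U. w \<in> W \<Longrightarrow> U \<in> Poly_Mapping.keys w \<Longrightarrow> finite U"
    and closed: "\<And>w. w \<in> W \<Longrightarrow> contraction t w \<in> W'"
  shows "T - {t} \<in> leading set_encode W'"
proof -
  obtain w where w: "w \<in> W" "T \<in> Poly_Mapping.keys w"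
    and max: "\<And>U. U \<in> Poly_Mapping.keys w \<Longrightarrow> set_encode U \<le> set_encode T"
    using assms(1) by (auto simp: leading_def)
  have enc: "set_encode (insert t U) = 2 ^ t + set_encode U" if "t \<notin> U" "insert t U \<in> Poly_Mapping.keys w" for U
    using that fin[OF w(1) that(2)] by simp
  have T: "insert t (T - {t}) = T" using assms(2) by auto
  have "set_encode U \<le> set_encode (T - {t})" if "U \<in> Poly_Mapping.keys (contraction t w)" for U
    using that enc[of U] enc[of "T - {t}"] max[of "insert t U"] T w(2) by (simp add: keys_contraction)
  moreover have "T - {t} \<in> Poly_Mapping.keys (contraction t w)"
    using T w(2) by (simp add: keys_contraction)
  ultimately show ?thesis using closed[OF w(1)] by (auto simp: leading_def)
qed

text \<open>Let \<open>\<rho>\<close> be the projection along the subcomplex, the identity minus \<open>\<phi> \<circ> \<psi>\<close>. For an element \<open>u\<close> of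
  the subcomplex, \<open>\<rho>\<close> kills the differential of \<open>u\<close>, so every coordinate of the projected contractions
  of \<open>u\<close> is a syzygy of \<open>f\<close>. Its coefficients have no constant term, which means that the
  contractions of \<open>u\<close> agree, modulo the variables, with elements of the subcomplex.\<close>
lemma contraction_residue_image:
  fixes f :: "nat \<Rightarrow> ('n, 'k::field) mpoly" and F :: "('b, ('n, 'k) mpoly) based_complex"
  assumes hom: "\<forall>i\<in>{1..m}. homogeneous (f i)" and reg: "regular_sequence m f"
    and F: "free_complex F"
    and split: "\<And>i. split_injective (basis F i) (basis (koszul m f) i) (\<phi> i)"
    and comm: "\<And>i v. v \<in> free_module (basis F (Suc i)) \<Longrightarrow>
      \<phi> i (diff F (Suc i) v) = diff (koszul m f) (Suc i) (\<phi> (Suc i) v)"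
    and w: "w \<in> residue_image (basis F (Suc d)) (\<phi> (Suc d))" and t: "t \<in> {1..m}"
  shows "contraction t w \<in> residue_image (basis F d) (\<phi> d)"
proof -
  obtain v where v: "v \<in> free_module (basis F (Suc d))" "w = residue (\<phi> (Suc d) v)"
    using w by (auto simp: residue_image_def)
  define u where "u = \<phi> (Suc d) v"
  have u: "u \<in> free_module (basis (koszul m f) (Suc d))"
    using split[of "Suc d"] v(1) by (auto simp: split_injective_def free_hom_def u_def)
  obtain \<psi> where hom\<phi>: "module_hom fm_scale fm_scale (\<phi> d)" and hom\<psi>: "module_hom fm_scale fm_scale \<psi>"
    and \<psi>: "\<psi> ` free_module (basis (koszul m f) d) \<subseteq> free_module (basis F d)"
    and inv: "\<And>v. v \<in> free_module (basis F d) \<Longrightarrow> \<psi> (\<phi> d v) = v"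
    using split[of d] by (auto simp: split_injective_def free_hom_def)
  interpret \<phi>: module_hom fm_scale fm_scale "\<phi> d" by (rule hom\<phi>)
  interpret \<psi>: module_hom fm_scale fm_scale \<psi> by (rule hom\<psi>)
  define \<rho> where "\<rho> x = x - \<phi> d (\<psi> x)" for x
  have dv: "diff F (Suc d) v \<in> free_module (basis F d)"
    using F v(1) by (auto simp: free_complex_def free_hom_def)
  have sum_u: "(\<Sum>s\<in>{1..m}. fm_scale (f s) (contraction s u)) = \<phi> d (diff F (Suc d) v)"
  proof -
    have "Poly_Mapping.keys u \<subseteq> Pow {1..m}"
      using u by (auto simp: free_module_def koszul_def)
    from koszul_diff_eq_contractions[OF this, of f] show ?thesis
      using comm[OF v(1)] by (simp add: koszul_def u_def)
  qed
  have "(\<Sum>s\<in>{1..m}. fm_scale (f s) (\<rho> (contraction s u))) = \<rho> (\<Sum>s\<in>{1..m}. fm_scale (f s) (contraction s u))"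
    by (simp add: \<rho>_def \<phi>.sum \<psi>.sum \<phi>.scale \<psi>.scale module.scale_right_diff_distrib[OF module_fm_scale] sum_subtractf)
  also have "\<dots> = 0" unfolding sum_u by (simp add: \<rho>_def inv[OF dv])
  finally have zero: "(\<Sum>s\<in>{1..m}. fm_scale (f s) (\<rho> (contraction s u))) = 0" .
  have reg': "\<forall>i\<in>{1..m}. \<forall>g. f i * g \<in> ideal_gen (f ` {1..<i}) \<longrightarrow> g \<in> ideal_gen (f ` {1..<i})"
    using reg unfolding regular_sequence_def by (rule conjunct1)
  have const_coeff_f: "const_coeff (f i) = 0" if "i \<in> {1..m}" for i
    using const_coeff_regular_sequence[OF _ reg that] hom that by blast
  have "residue (\<rho> (contraction t u)) = 0"
  proof (rule poly_mapping_eqI)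
    fix U
    have "(\<Sum>s\<in>{1..m}. f s * Poly_Mapping.lookup (\<rho> (contraction s u)) U) = 0"
      using arg_cong[OF zero, of "\<lambda>x. Poly_Mapping.lookup x U"]
      by (simp add: lookup_sum lookup_fm_scale)
    note in_ideal = regular_syzygy_in_ideal[OF reg' this t]
    have "const_coeff (Poly_Mapping.lookup (\<rho> (contraction t u)) U) = 0"
      by (rule const_coeff_ideal_gen[OF const_coeff_f in_ideal finite_atLeastAtMost])
    then show "Poly_Mapping.lookup (residue (\<rho> (contraction t u))) U = Poly_Mapping.lookup 0 U"
      by (simp add: lookup_residue)
  qed
  then have "residue (contraction t u) = residue (\<phi> d (\<psi> (contraction t u)))"
    by (simp add: \<rho>_def residue_diff)
  moreover have "contraction t u \<in> free_module (basis (koszul m f) d)"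
  proof -
    have "U \<subseteq> {1..m} \<and> card U = d" if "U \<in> Poly_Mapping.keys (contraction t u)" for U
    proof -
      have "t \<notin> U" "insert t U \<in> Poly_Mapping.keys u" using that by (simp_all add: keys_contraction)
      then have "t \<notin> U" "insert t U \<subseteq> {1..m}" "card (insert t U) = Suc d"
        using u by (auto simp: free_module_def koszul_def)
      moreover from this have "finite U" by (metis finite_atLeastAtMost finite_insert finite_subset)
      ultimately show ?thesis by simp
    qed
    then show ?thesis by (auto simp: free_module_def koszul_def)
  qed
  then have "\<psi> (contraction t u) \<in> free_module (basis F d)" using \<psi> by blast
  ultimately show ?thesis
    using v(2) by (auto simp: residue_image_def residue_contraction[symmetric] u_def)
qed

text \<open>The faces are the leading sets of the residues of the subcomplex.\<close>
proposition koszul_rank_seq_simplicial: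
  fixes f :: "nat \<Rightarrow> ('n, 'k::field) mpoly"
  assumes "\<forall>i\<in>{1..m}. homogeneous (f i)" "regular_sequence m f" "r \<in> RS (koszul m f)"
  obtains \<Delta> where "\<And>d. \<Delta> d \<subseteq> {T. T \<subseteq> {1..m} \<and> card T = d}" "\<And>d. card (\<Delta> d) = r d"
    "\<And>d T t. T \<in> \<Delta> (Suc d) \<Longrightarrow> t \<in> T \<Longrightarrow> T - {t} \<in> \<Delta> d"
proof -
  obtain F :: "(nat, ('n, 'k) mpoly) based_complex" and \<phi> where F: "free_complex F" "r = rank_seq F"
    and split: "\<And>i. split_injective (basis F i) (basis (koszul m f) i) (\<phi> i)"
    and comm: "\<And>i v. v \<in> free_module (basis F (Suc i)) \<Longrightarrow>
      \<phi> i (diff F (Suc i) v) = diff (koszul m f) (Suc i) (\<phi> (Suc i) v)"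
  proof -
    obtain F :: "(nat, ('n, 'k) mpoly) based_complex"
      where F: "r = rank_seq F" "free_complex F" "subcomplex F (koszul m f)"
      using assms(3) unfolding RS_def by blast
    then obtain \<phi> where
      "\<forall>i. split_injective (basis F i) (basis (koszul m f) i) (\<phi> i)"
      "\<forall>i. \<forall>v\<in>free_module (basis F (Suc i)).
        \<phi> i (diff F (Suc i) v) = diff (koszul m f) (Suc i) (\<phi> (Suc i) v)"
      unfolding subcomplex_def by blast
    then show thesis using that[OF F(2,1), of \<phi>] by blast
  qed
  define W where "W d = residue_image (basis F d) (\<phi> d)" for d
  let ?C = "\<lambda>d. {T. T \<subseteq> {1..m} \<and> card T = d}"
  have keysW: "Poly_Mapping.keys w \<subseteq> ?C d" if w: "w \<in> W d" for w d
  proof -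
    obtain v where v: "v \<in> free_module (basis F d)" "w = residue (\<phi> d v)"
      using w by (auto simp: W_def residue_image_def)
    have "\<phi> d v \<in> free_module (basis (koszul m f) d)"
      using split[of d] v(1) by (auto simp: split_injective_def free_hom_def)
    then have "Poly_Mapping.keys (\<phi> d v) \<subseteq> ?C d"
      by (simp add: free_module_def koszul_def)
    moreover have "Poly_Mapping.keys w \<subseteq> Poly_Mapping.keys (\<phi> d v)"
      using v(2) by (auto simp: in_keys_iff lookup_residue)
    ultimately show ?thesis by blast
  qed
  have finC: "finite T" if "T \<in> ?C d" for T d using that finite_subset by blast
  show thesis
  proof
    show "leading set_encode (W d) \<subseteq> ?C d" for d
      using keysW by (fastforce simp: leading_def)
    show "card (leading set_encode (W d)) = r d" for d
    proof -
      have "finite (basis F d)" using F(1) by (simp add: free_complex_def)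
      from residue_image_basis[OF split this]
      obtain X where X: "fm.independent X" "card X = card (basis F d)" "W d = fm.span X"
        unfolding W_def by metis
      have "inj_on set_encode (?C d)"
        using inj_on_set_encode by (rule inj_on_subset) (use finC in auto)
      then have "card (leading set_encode (fm.span X)) = card X"
      proof (rule card_leading[OF X(1), rotated])
        show "finite (?C d)" by simp
        show "Poly_Mapping.keys w \<subseteq> ?C d" if "w \<in> fm.span X" for w
          using that keysW[of w d] by (simp only: X(3))
      qed
      then show ?thesis using X F(2) by (simp add: rank_seq_def)
    qed
    show "T - {t} \<in> leading set_encode (W d)" if T: "T \<in> leading set_encode (W (Suc d))" "t \<in> T" for d T t
    proof (rule leading_contraction[OF T])
      show "finite U" if "w \<in> W (Suc d)" "U \<in> Poly_Mapping.keys w" for w U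
        by (rule finC[OF subsetD[OF keysW[OF that(1)] that(2)]])
      obtain w where "w \<in> W (Suc d)" "T \<in> Poly_Mapping.keys w"
        using T(1) by (auto simp: leading_def)
      then have "T \<subseteq> {1..m}" using keysW[of w "Suc d"] by blast
      then have t: "t \<in> {1..m}" using T(2) by (rule subsetD)
      show "contraction t w \<in> W d" if "w \<in> W (Suc d)" for w
        unfolding W_def
        by (rule contraction_residue_image[OF assms(1,2) F(1) split comm that[unfolded W_def] t])
    qed
  qed
qed

lemma lin_ext_free_module:
  assumes "\<And>b. b \<in> B \<Longrightarrow> h b \<in> free_module C" "v \<in> free_module B"
  shows "lin_ext h v \<in> free_module C"
proof -
  have "Poly_Mapping.lookup (lin_ext h v) c = 0" if "c \<notin> C" for c
  proof -
    have "Poly_Mapping.lookup (h b) c = 0" if "b \<in> Poly_Mapping.keys v" for b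
    proof -
      have "b \<in> B" using assms(2) that by (auto simp: free_module_def)
      then have "Poly_Mapping.keys (h b) \<subseteq> C" using assms(1) by (simp add: free_module_def)
      then show ?thesis using \<open>c \<notin> C\<close> by (auto simp: in_keys_iff)
    qed
    then show ?thesis by (simp add: lookup_lin_ext[OF _ order_refl])
  qed
  then show ?thesis by (auto simp: free_module_def in_keys_iff)
qed

lemma lin_ext_cong:
  "(\<And>b. b \<in> Poly_Mapping.keys v \<Longrightarrow> h b = h' b) \<Longrightarrow> lin_ext h v = lin_ext h' v"
  by (simp add: lin_ext_def)

lemma lin_ext_lin_ext: "lin_ext g (lin_ext h v) = lin_ext (\<lambda>b. lin_ext g (h b)) v"
proof -
  interpret module_hom fm_scale fm_scale "lin_ext g" by (rule module_hom_lin_ext)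
  show ?thesis unfolding lin_ext_def[of h] lin_ext_def[of "\<lambda>b. lin_ext g (h b)"]
    by (simp add: sum scale)
qed

lemma lin_ext_ident: "lin_ext (\<lambda>b. Poly_Mapping.single b 1) v = v"
  using poly_mapping_expand[of v] by (simp add: lin_ext_def fm_scale_single)

text \<open>The faces become basis elements indexed by \<^typ>\<open>nat\<close> through \<open>set_encode\<close>. The maps \<open>\<phi>\<close> and \<open>\<psi>\<close>
  relabel between numbers and sets; the splitting \<open>\<psi>'\<close> in degree \<open>d\<close> relabels the faces and kills the
  basis elements of the Koszul complex that are not faces.\<close>
proposition simplicial_rank_seq_koszul:
  fixes f :: "nat \<Rightarrow> 'a::comm_ring_1"
  assumes \<Delta>: "\<And>d. \<Delta> d \<subseteq> {T. T \<subseteq> {1..m} \<and> card T = d}"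
    and closed: "\<And>d T t. T \<in> \<Delta> (Suc d) \<Longrightarrow> t \<in> T \<Longrightarrow> T - {t} \<in> \<Delta> d"
  shows "(\<lambda>d. card (\<Delta> d)) \<in> RS (koszul m f)"
proof -
  define \<phi> :: "(nat \<Rightarrow>\<^sub>0 'a) \<Rightarrow> (nat set \<Rightarrow>\<^sub>0 'a)"
    where "\<phi> = lin_ext (\<lambda>n. Poly_Mapping.single (set_decode n) 1)"
  define \<psi> :: "(nat set \<Rightarrow>\<^sub>0 'a) \<Rightarrow> (nat \<Rightarrow>\<^sub>0 'a)"
    where "\<psi> = lin_ext (\<lambda>T. Poly_Mapping.single (set_encode T) 1)"
  define \<psi>' :: "nat \<Rightarrow> (nat set \<Rightarrow>\<^sub>0 'a) \<Rightarrow> (nat \<Rightarrow>\<^sub>0 'a)"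
    where "\<psi>' d = lin_ext (\<lambda>T. if T \<in> \<Delta> d then Poly_Mapping.single (set_encode T) 1 else 0)" for d
  define F where "F = \<lparr> basis = (\<lambda>d. set_encode ` \<Delta> d), diff = (\<lambda>_ v. \<psi> (koszul_diff f (\<phi> v))) \<rparr>"
  have finT: "finite T" if "T \<in> \<Delta> d" for T d
    using that \<Delta> finite_subset by blast
  have fin\<Delta>: "finite (\<Delta> d)" for d
    by (rule finite_subset[OF \<Delta>]) simp
  have single: "Poly_Mapping.single x (1 :: 'a) \<in> free_module B" if "x \<in> B" for x :: 'x and B
    using that by (simp add: free_module_def)
  have hom\<phi>: "module_hom fm_scale fm_scale \<phi>" and hom\<psi>: "module_hom fm_scale fm_scale \<psi>"
    and hom\<psi>': "module_hom fm_scale fm_scale (\<psi>' d)"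
    and homd: "module_hom fm_scale fm_scale (koszul_diff f)" for d
    by (simp_all add: \<phi>_def \<psi>_def \<psi>'_def koszul_diff_eq_lin_ext module_hom_lin_ext)
  have \<phi>: "\<phi> v \<in> free_module (\<Delta> d)" if "v \<in> free_module (set_encode ` \<Delta> d)" for v d
    unfolding \<phi>_def by (rule lin_ext_free_module[OF _ that]) (auto simp: set_encode_inverse[OF finT] intro!: single)
  have \<psi>: "\<psi> v \<in> free_module (set_encode ` \<Delta> d)" if "v \<in> free_module (\<Delta> d)" for v d
    unfolding \<psi>_def by (rule lin_ext_free_module[OF _ that]) (auto intro!: single)
  have \<psi>': "\<psi>' d v \<in> free_module (set_encode ` \<Delta> d)" for v d
    unfolding \<psi>'_def by (rule lin_ext_free_module[of UNIV]) (auto simp: free_module_def)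
  have kd: "koszul_diff f v \<in> free_module (\<Delta> d)" if "v \<in> free_module (\<Delta> (Suc d))" for v d
    unfolding koszul_diff_eq_lin_ext
  proof (rule lin_ext_free_module[OF _ that])
    fix T assume T: "T \<in> \<Delta> (Suc d)"
    have "Poly_Mapping.lookup (\<Sum>t\<in>T. Poly_Mapping.single (T - {t}) ((- 1) ^ card {s \<in> T. s \<le> t} * f t)) U = 0"
      if "U \<notin> \<Delta> d" for U
      using closed[OF T] that unfolding lookup_sum
      by (intro sum.neutral) (auto simp: lookup_single when_def)
    then show "(\<Sum>t\<in>T. Poly_Mapping.single (T - {t}) ((- 1) ^ card {s \<in> T. s \<le> t} * f t)) \<in> free_module (\<Delta> d)"
      by (auto simp: free_module_def in_keys_iff)
  qed
  have \<phi>\<psi>: "\<phi> (\<psi> v) = v" if "v \<in> free_module (\<Delta> d)" for v d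
  proof -
    have "\<phi> (\<psi> v) = lin_ext (\<lambda>T. Poly_Mapping.single T 1) v"
      unfolding \<phi>_def \<psi>_def lin_ext_lin_ext
      using that finT by (intro lin_ext_cong) (auto simp: lin_ext_single free_module_def)
    then show ?thesis by (simp add: lin_ext_ident)
  qed
  have \<psi>'\<phi>: "\<psi>' d (\<phi> v) = v" if "v \<in> free_module (set_encode ` \<Delta> d)" for v d
  proof -
    have "\<psi>' d (\<phi> v) = lin_ext (\<lambda>n. Poly_Mapping.single n 1) v"
      unfolding \<phi>_def \<psi>'_def lin_ext_lin_ext
      using that finT by (intro lin_ext_cong) (auto simp: lin_ext_single free_module_def)
    then show ?thesis by (simp add: lin_ext_ident)
  qed
  have "free_complex F"
    unfolding free_complex_def
  proof (intro conjI allI ballI)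
    fix d
    show "finite (basis F d)" by (simp add: F_def fin\<Delta>)
    have "module_hom fm_scale fm_scale (\<lambda>v. \<psi> (koszul_diff f (\<phi> v)))"
      using module_hom_compose[OF module_hom_compose[OF hom\<phi> homd] hom\<psi>] by (simp add: o_def)
    then show "free_hom (basis F (Suc d)) (basis F d) (diff F (Suc d))"
      by (auto simp: free_hom_def F_def intro!: \<psi> kd \<phi>)
    fix v :: "nat \<Rightarrow>\<^sub>0 'a" assume "v \<in> free_module (basis F (Suc (Suc d)))"
    then have v: "\<phi> v \<in> free_module (\<Delta> (Suc (Suc d)))" by (simp add: F_def \<phi>)
    then have "Poly_Mapping.keys (\<phi> v) \<subseteq> Pow {1..m}" using \<Delta> by (fastforce simp: free_module_def)
    then have "koszul_diff f (koszul_diff f (\<phi> v)) = 0" by (rule koszul_diff_koszul_diff)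
    then show "diff F (Suc d) (diff F (Suc (Suc d)) v) = 0"
      using \<phi>\<psi>[OF kd[OF v]] module_hom.zero[OF hom\<psi>] by (simp add: F_def)
  qed
  moreover have "subcomplex F (koszul m f)"
    unfolding subcomplex_def
  proof (intro exI[of _ "\<lambda>_. \<phi>"] conjI allI ballI)
    fix d
    have "free_hom (basis F d) (basis (koszul m f) d) \<phi>"
      using hom\<phi> \<phi> \<Delta> by (fastforce simp: free_hom_def F_def koszul_def free_module_def)
    moreover have "free_hom (basis (koszul m f) d) (basis F d) (\<psi>' d)"
      using hom\<psi>' \<psi>' by (auto simp: free_hom_def F_def)
    ultimately show "split_injective (basis F d) (basis (koszul m f) d) \<phi>"
      unfolding split_injective_def using \<psi>'\<phi> by (auto simp: F_def)
    fix v :: "nat \<Rightarrow>\<^sub>0 'a" assume "v \<in> free_module (basis F (Suc d))"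
    then show "\<phi> (diff F (Suc d) v) = diff (koszul m f) (Suc d) (\<phi> v)"
      using \<phi>\<psi>[OF kd[OF \<phi>]] by (simp add: F_def koszul_def)
  qed
  moreover have "rank_seq F = (\<lambda>d. card (\<Delta> d))"
  proof
    fix d
    have "inj_on set_encode (\<Delta> d)"
      using inj_on_set_encode by (rule inj_on_subset) (use finT in auto)
    then show "rank_seq F d = card (\<Delta> d)" by (simp add: rank_seq_def F_def card_image)
  qed
  ultimately show ?thesis unfolding RS_def by (metis (mono_tags, lifting) mem_Collect_eq)
qed

theorem theorem1:
  fixes f :: "nat \<Rightarrow> ('n::finite, 'k::field) mpoly" and m :: nat and r :: "nat \<Rightarrow> nat"
  assumes "\<forall>i\<in>{1..m}. homogeneous (f i)"
    and "regular_sequence m f"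
    and "\<forall>i>m. r i = 0"
  shows "r \<in> RS (koszul m f) \<longleftrightarrow>
    (\<forall>i. r i = 0) \<or>
    (r 0 = 1 \<and> r 1 \<le> m \<and>
     (\<forall>i. 1 \<le> i \<and> i < m \<longrightarrow> r (i + 1) \<le> macaulay_up (r i) i))"
proof
  assume "r \<in> RS (koszul m f)"
  then obtain \<Delta> where \<Delta>: "\<And>d. \<Delta> d \<subseteq> {T. T \<subseteq> {1..m} \<and> card T = d}" "\<And>d. card (\<Delta> d) = r d"
    and closed: "\<And>d T t. T \<in> \<Delta> (Suc d) \<Longrightarrow> t \<in> T \<Longrightarrow> T - {t} \<in> \<Delta> d"
    using koszul_rank_seq_simplicial[OF assms(1,2)] by blast
  have fin: "finite (\<Delta> d)" for d by (rule finite_subset[OF \<Delta>(1)]) simp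
  have ne: "\<Delta> 0 \<noteq> {}" if "\<Delta> d \<noteq> {}" for d
    using that
  proof (induction d)
    case (Suc d)
    then obtain T where T: "T \<in> \<Delta> (Suc d)" by blast
    then have "T \<noteq> {}" using \<Delta>(1) by fastforce
    then show ?case using closed[OF T] Suc.IH by blast
  qed
  have "\<Delta> 0 \<subseteq> {{}}"
  proof
    fix T assume "T \<in> \<Delta> 0"
    then have "T \<subseteq> {1..m}" "card T = 0" using \<Delta>(1) by blast+
    then show "T \<in> {{}}" by (metis card_0_eq finite_atLeastAtMost finite_subset singletonI)
  qed
  then have "r 0 = 1" if "r d \<noteq> 0" for d
    using ne[of d] that \<Delta>(2)[of d] \<Delta>(2)[of 0] by (cases "\<Delta> d = {}") (auto simp: subset_singleton_iff)
  moreover have "r 1 \<le> m"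
    using card_mono[OF _ \<Delta>(1)[of 1]] \<Delta>(2)[of 1] n_subsets[of "{1..m}" 1] by simp
  moreover have "r (i + 1) \<le> macaulay_up (r i) i" if "1 \<le> i" for i
  proof -
    have "shadow (\<Delta> (Suc i)) \<subseteq> \<Delta> i" using closed by (auto simp: shadow_def)
    then have "card (\<Delta> (Suc i)) \<le> macaulay_up (card (\<Delta> i)) i"
      using \<Delta>(1) fin that by (intro kruskal_katona_macaulay[of "{1..m}"]) auto
    then show ?thesis by (simp add: \<Delta>(2))
  qed
  ultimately show "(\<forall>i. r i = 0) \<or> (r 0 = 1 \<and> r 1 \<le> m \<and>
      (\<forall>i. 1 \<le> i \<and> i < m \<longrightarrow> r (i + 1) \<le> macaulay_up (r i) i))"
    by blast
next
  assume "(\<forall>i. r i = 0) \<or> (r 0 = 1 \<and> r 1 \<le> m \<and>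
      (\<forall>i. 1 \<le> i \<and> i < m \<longrightarrow> r (i + 1) \<le> macaulay_up (r i) i))"
  then show "r \<in> RS (koszul m f)"
  proof
    assume "\<forall>i. r i = 0"
    then have "r = (\<lambda>d. card ({} :: nat set set))" by auto
    also have "\<dots> \<in> RS (koszul m f)" by (rule simplicial_rank_seq_koszul) auto
    finally show ?thesis .
  next
    assume r: "r 0 = 1 \<and> r 1 \<le> m \<and> (\<forall>i. 1 \<le> i \<and> i < m \<longrightarrow> r (i + 1) \<le> macaulay_up (r i) i)"
    then have step: "r (Suc i) \<le> macaulay_up (r i) i" if "0 < i" for i
      using that assms(3) by (cases "i < m") auto
    have seg0: "colex_segment 0 (r 0) = {{}}" using r by (auto simp: colex_segment_def)
    \<comment> \<open>Ranks refer to subsets of \<open>{0..<m}\<close>, the Koszul complex to subsets of \<open>{1..m}\<close>.\<close>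
    define \<Delta> where "\<Delta> d = (`) Suc ` colex_segment d (r d)" for d
    have "card (\<Delta> d) = card (colex_segment d (r d))" for d
      unfolding \<Delta>_def by (intro card_image inj_onI) (simp add: inj_image_eq_iff)
    moreover have "card (colex_segment d (r d)) = r d" for d
      using r seg0 by (cases d) auto
    ultimately have "r = (\<lambda>d. card (\<Delta> d))" by auto
    also have "\<dots> \<in> RS (koszul m f)"
    proof (rule simplicial_rank_seq_koszul)
      show "\<Delta> d \<subseteq> {T. T \<subseteq> {1..m} \<and> card T = d}" for d
      proof
        fix T assume "T \<in> \<Delta> d"
        then obtain A where A: "T = Suc ` A" "A \<in> colex_segment d (r d)" by (auto simp: \<Delta>_def)
        then have "A \<subseteq> {..<m}" using r step by (intro colex_segment_subset_lessThan[of r m A d]) auto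
        then show "T \<in> {T. T \<subseteq> {1..m} \<and> card T = d}"
          using A by (auto simp: colex_segment_def card_image)
      qed
      show "T - {t} \<in> \<Delta> d" if T: "T \<in> \<Delta> (Suc d)" "t \<in> T" for d T t
      proof -
        obtain A x where A: "T = Suc ` A" "A \<in> colex_segment (Suc d) (r (Suc d))" "x \<in> A" "t = Suc x"
          using T by (auto simp: \<Delta>_def)
        have "A - {x} \<in> colex_segment d (r d)"
        proof (cases d)
          case 0
          then show ?thesis using A(2,3) seg0 by (auto simp: colex_segment_def card_Suc_eq)
        next
          case (Suc e)
          then show ?thesis using A(2,3) step[of d] by (intro colex_segment_delete) auto
        qed
        moreover have "T - {t} = Suc ` (A - {x})" using A by auto
        ultimately show ?thesis by (auto simp: \<Delta>_def)
      qed
    qed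
    finally show ?thesis .
  qed
qed

end
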